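(* Consider a sequence of multiple testing problems indexed by the number of tests $m\to\infty$, with parameters $p=p_m$, $\tau^2=\tau_m^2$, $\sigma^2=\sigma_m^2$, $\delta_0=\delta_{0m}$, $\delta_A=\delta_{Am}$ such that, with $u=\tau^2/\sigma^2$, $f=(1-p)/p$, $\delta=\delta_0/\delta_A$ and $v=uf^2\delta^2$, as $m\to\infty$: $p\to 0$, $u\to\infty$, $v\to\infty$ and $\frac{\log v}{u}\to C\in(0,\infty)$. Suppose $p\propto m^{-\beta}$ with $0<\beta\le1$, and that $\delta$ is constant (does not depend on $m$). Then the Benjamini–Hochberg procedure at FDR level $\alpha=\alpha_m\in(0,1)$ is ABOS if $\alpha_m$ converges to $0$ in such a way that $\log\alpha_m=o(\log m)$.
   Context: Model. Given a number of tests $m\ge 1$ and parameters $p\in(0,1)$, $\sigma^2>0$ (known), $\tau^2>0$, let $(\nu_i,X_i)$, $i=1,\dots,m$, be i.i.d. with $P(\nu_i=1)=p=1-P(\nu_i=0)$, $X_i\mid\nu_i=0\sim N(0,\sigma^2)$ and $X_i\mid\nu_i=1\sim N(0,\sigma^2+\tau^2)$. Only the $X_i$ are observed. The null hypothesis $H_{0i}$ is the event $\nu_i=0$, the alternative $H_{Ai}$ is $\nu_i=1$. A type I error (rejecting a true $H_{0i}$) costs $\delta_0>0$, a type II error (accepting $H_{0i}$ when $H_{Ai}$ holds) costs $\delta_A>0$, and the total loss is the sum over the $m$ tests. The Bayes risk of a multiple testing rule is $R=\delta_0E(V)+\delta_AE(T)$, where $V$ is the number of false rejections and $T$ the number of false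 acceptances. Bayes oracle: the rule minimizing $R$; it rejects $H_{0i}$ iff $X_i^2/\sigma^2\ge(1+\frac1u)\left(\log v+\log(1+\frac1u)\right)$, where $u=\tau^2/\sigma^2$, $f=(1-p)/p$, $\delta=\delta_0/\delta_A$, $v=uf^2\delta^2$. Its Bayes risk is denoted $R_{\mathrm{opt}}$. ABOS (asymptotically Bayes optimal under sparsity): a rule with risk $R$ is ABOS if $R/R_{\mathrm{opt}}\to1$ as $m\to\infty$. Benjamini–Hochberg procedure (BH) at FDR level $\alpha$: let $Z_i=|X_i|/\sigma$, $p_i=2(1-\Phi(Z_i))$ ($\Phi$ the standard normal cdf), $p_{(1)}\le\dots\le p_{(m)}$ the ordered $p$-values, and $k=\max\{i: p_{(i)}\le i\alpha/m\}$. BH rejects all null hypotheses whose $p$-value is at most $p_{(k)}$ (and rejects nothing if no such $i$ exists). $a_m\propto b_m$ means that $a_m/b_m$ converges to a constant in $(0,\infty)$. *)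

theory Defs
  imports "HOL-Probability.Probability" "HOL-Library.Landau_Symbols"
begin

text \<open>
  The two-groups model for \<open>m\<close> tests, indexed by \<open>i \<in> {1..m}\<close>. The parameters \<open>\<sigma>\<close> and \<open>\<tau>\<close>
  are the positive square roots of the variances \<open>\<sigma>\<^sup>2\<close> and \<open>\<tau>\<^sup>2\<close>; note that \<open>normal_density\<close> takes
  a standard deviation. That the pairs \<open>(\<nu> i, X i)\<close> are identically distributed follows from
  \<open>prob_null\<close> to \<open>X_alternative\<close>, and their measurability is part of \<open>indep_vars\<close>.
\<close>

locale two_groups = prob_space M
  for M :: "'a measure" and m :: nat and p \<sigma> \<tau> :: real
    and \<nu> :: "nat \<Rightarrow> 'a \<Rightarrow> nat" and X :: "nat \<Rightarrow> 'a \<Rightarrow> real" +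
  assumes p_bounds: "0 < p" "p < 1"
    and sd_pos: "0 < \<sigma>" "0 < \<tau>"
    and indep: "indep_vars (\<lambda>_. count_space UNIV \<Otimes>\<^sub>M borel) (\<lambda>i \<omega>. (\<nu> i \<omega>, X i \<omega>)) {1..m}"
    and prob_null: "\<And>i. i \<in> {1..m} \<Longrightarrow> \<P>(\<omega> in M. \<nu> i \<omega> = 0) = 1 - p"
    and prob_alternative: "\<And>i. i \<in> {1..m} \<Longrightarrow> \<P>(\<omega> in M. \<nu> i \<omega> = 1) = p"
    and X_null: "\<And>i A. i \<in> {1..m} \<Longrightarrow> A \<in> sets borel \<Longrightarrow>
      \<P>(\<omega> in M. X i \<omega> \<in> A \<bar> \<nu> i \<omega> = 0) = measure (density lborel (normal_density 0 \<sigma>)) A"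
    and X_alternative: "\<And>i A. i \<in> {1..m} \<Longrightarrow> A \<in> sets borel \<Longrightarrow>
      \<P>(\<omega> in M. X i \<omega> \<in> A \<bar> \<nu> i \<omega> = 1) =
        measure (density lborel (normal_density 0 (sqrt (\<sigma>\<^sup>2 + \<tau>\<^sup>2)))) A"

definition u_param :: "real \<Rightarrow> real \<Rightarrow> real" where
  "u_param \<sigma> \<tau> = \<tau>\<^sup>2 / \<sigma>\<^sup>2"

definition f_param :: "real \<Rightarrow> real" where
  "f_param p = (1 - p) / p"

definition v_param :: "real \<Rightarrow> real \<Rightarrow> real \<Rightarrow> real \<Rightarrow> real \<Rightarrow> real" where
  "v_param p \<sigma> \<tau> \<delta>\<^sub>0 \<delta>\<^sub>A = u_param \<sigma> \<tau> * (f_param p)\<^sup>2 * (\<delta>\<^sub>0 / \<delta>\<^sub>A)\<^sup>2"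

text \<open>A multiple testing rule maps the observations to the set of indices of the rejected nulls.\<close>

type_synonym testing_rule = "(nat \<Rightarrow> real) \<Rightarrow> nat set"

text \<open>The restriction to \<open>{1..m}\<close> expresses that a rule only sees \<open>X\<^sub>1, \<dots>, X\<^sub>m\<close>.\<close>

definition rejected :: "nat \<Rightarrow> (nat \<Rightarrow> 'a \<Rightarrow> real) \<Rightarrow> testing_rule \<Rightarrow> 'a \<Rightarrow> nat set" where
  "rejected m X r \<omega> = r (\<lambda>i\<in>{1..m}. X i \<omega>)"

definition false_rejections ::
  "nat \<Rightarrow> (nat \<Rightarrow> 'a \<Rightarrow> nat) \<Rightarrow> (nat \<Rightarrow> 'a \<Rightarrow> real) \<Rightarrow> testing_rule \<Rightarrow> 'a \<Rightarrow> nat" where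
  "false_rejections m \<nu> X r \<omega> = card {i \<in> {1..m}. i \<in> rejected m X r \<omega> \<and> \<nu> i \<omega> = 0}"

definition false_acceptances ::
  "nat \<Rightarrow> (nat \<Rightarrow> 'a \<Rightarrow> nat) \<Rightarrow> (nat \<Rightarrow> 'a \<Rightarrow> real) \<Rightarrow> testing_rule \<Rightarrow> 'a \<Rightarrow> nat" where
  "false_acceptances m \<nu> X r \<omega> = card {i \<in> {1..m}. i \<notin> rejected m X r \<omega> \<and> \<nu> i \<omega> = 1}"

definition bayes_risk ::
  "'a measure \<Rightarrow> nat \<Rightarrow> (nat \<Rightarrow> 'a \<Rightarrow> nat) \<Rightarrow> (nat \<Rightarrow> 'a \<Rightarrow> real) \<Rightarrow> real \<Rightarrow> real
    \<Rightarrow> testing_rule \<Rightarrow> real" where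
  "bayes_risk M m \<nu> X \<delta>\<^sub>0 \<delta>\<^sub>A r =
     \<delta>\<^sub>0 * (\<integral>\<omega>. real (false_rejections m \<nu> X r \<omega>) \<partial>M) +
     \<delta>\<^sub>A * (\<integral>\<omega>. real (false_acceptances m \<nu> X r \<omega>) \<partial>M)"

definition bayes_oracle :: "nat \<Rightarrow> real \<Rightarrow> real \<Rightarrow> real \<Rightarrow> real \<Rightarrow> real \<Rightarrow> testing_rule" where
  "bayes_oracle m p \<sigma> \<tau> \<delta>\<^sub>0 \<delta>\<^sub>A x =
     {i \<in> {1..m}. (x i)\<^sup>2 / \<sigma>\<^sup>2 \<ge>
        (1 + 1 / u_param \<sigma> \<tau>) * (ln (v_param p \<sigma> \<tau> \<delta>\<^sub>0 \<delta>\<^sub>A) + ln (1 + 1 / u_param \<sigma> \<tau>))}"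

text \<open>
  The threshold rule above minimizes the Bayes risk among all measurable rules
  (\<open>bayes_oracle_minimizes_risk\<close> below), so its risk is the optimal one.
\<close>

lemma oracle_iff_density:
  assumes "0 < p" "p < 1" "0 < \<sigma>" "0 < \<tau>" "0 < \<delta>\<^sub>0" "0 < \<delta>\<^sub>A"
  shows "x\<^sup>2 / \<sigma>\<^sup>2 \<ge> (1 + 1 / u_param \<sigma> \<tau>) *
             (ln (v_param p \<sigma> \<tau> \<delta>\<^sub>0 \<delta>\<^sub>A) + ln (1 + 1 / u_param \<sigma> \<tau>)) \<longleftrightarrow>
         \<delta>\<^sub>A * p * normal_density 0 (sqrt (\<sigma>\<^sup>2 + \<tau>\<^sup>2)) x \<ge>
           \<delta>\<^sub>0 * (1 - p) * normal_density 0 \<sigma> x"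
proof -
  define u where "u = u_param \<sigma> \<tau>"
  have u: "u > 0" using assms by (simp add: u_def u_param_def)
  have s: "\<sigma>\<^sup>2 + \<tau>\<^sup>2 = \<sigma>\<^sup>2 * (1 + u)" using assms by (simp add: u_def u_param_def field_simps)
  define L where "L = \<delta>\<^sub>0 * (1 - p) / (\<delta>\<^sub>A * p)"
  have L: "L > 0" using assms by (simp add: L_def)
  have v: "v_param p \<sigma> \<tau> \<delta>\<^sub>0 \<delta>\<^sub>A = u * L\<^sup>2"
    unfolding v_param_def u_def L_def f_param_def by (simp add: power_divide power_mult_distrib mult_ac)
  have "v_param p \<sigma> \<tau> \<delta>\<^sub>0 \<delta>\<^sub>A * (1 + 1 / u) = L\<^sup>2 * (1 + u)"
    using u by (simp add: v field_simps)
  hence "ln (v_param p \<sigma> \<tau> \<delta>\<^sub>0 \<delta>\<^sub>A) + ln (1 + 1 / u) = ln (L\<^sup>2 * (1 + u))"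
    using u L ln_mult_pos[of "v_param p \<sigma> \<tau> \<delta>\<^sub>0 \<delta>\<^sub>A" "1 + 1 / u"]
    by (metis add_pos_pos mult_pos_pos v zero_less_divide_1_iff zero_less_one zero_less_power)
  also have "\<dots> = 2 * ln (L * sqrt (1 + u))"
    using u L by (simp add: ln_mult ln_sqrt power2_eq_square)
  finally have ln_eq: "ln (v_param p \<sigma> \<tau> \<delta>\<^sub>0 \<delta>\<^sub>A) + ln (1 + 1 / u) = 2 * ln (L * sqrt (1 + u))" .
  define e where "e = x\<^sup>2 / (2 * \<sigma>\<^sup>2) * (u / (1 + u))"
  have nd0: "normal_density 0 \<sigma> x = 1 / sqrt (2 * pi * \<sigma>\<^sup>2) * exp (- (x\<^sup>2 / (2 * \<sigma>\<^sup>2)))"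
    by (simp add: normal_density_def)
  have ee: "- (x\<^sup>2 / (2 * \<sigma>\<^sup>2)) + e = - (x\<^sup>2 / (2 * (\<sigma>\<^sup>2 * (1 + u))))"
  proof -
    have "u / (1 + u) = 1 - 1 / (1 + u)" using u by (simp add: field_simps)
    hence "e = x\<^sup>2 / (2 * \<sigma>\<^sup>2) - x\<^sup>2 / (2 * \<sigma>\<^sup>2) * (1 / (1 + u))"
      by (simp only: e_def right_diff_distrib mult_1_right)
    moreover have "x\<^sup>2 / (2 * \<sigma>\<^sup>2) * (1 / (1 + u)) = x\<^sup>2 / (2 * (\<sigma>\<^sup>2 * (1 + u)))"
      by (simp only: times_divide_times_eq mult_1_right mult.assoc)
    ultimately show ?thesis by linarith
  qed
  have "normal_density 0 (sqrt (\<sigma>\<^sup>2 + \<tau>\<^sup>2)) x =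
      1 / sqrt (2 * pi * (\<sigma>\<^sup>2 * (1 + u))) * exp (- (x\<^sup>2 / (2 * \<sigma>\<^sup>2)) + e)"
    using u unfolding ee by (simp add: normal_density_def s)
  also have "\<dots> = normal_density 0 \<sigma> x * (exp e / sqrt (1 + u))"
    unfolding nd0 exp_add by (simp add: real_sqrt_mult)
  finally have nd: "normal_density 0 (sqrt (\<sigma>\<^sup>2 + \<tau>\<^sup>2)) x =
    normal_density 0 \<sigma> x * (exp e / sqrt (1 + u))" .
  have n0: "normal_density 0 \<sigma> x > 0" using assms by (simp add: normal_density_pos)
  have "\<delta>\<^sub>A * p * normal_density 0 (sqrt (\<sigma>\<^sup>2 + \<tau>\<^sup>2)) x \<ge> \<delta>\<^sub>0 * (1 - p) * normal_density 0 \<sigma> x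
     \<longleftrightarrow> \<delta>\<^sub>A * p * (exp e / sqrt (1 + u)) * normal_density 0 \<sigma> x
           \<ge> \<delta>\<^sub>0 * (1 - p) * normal_density 0 \<sigma> x"
    unfolding nd by (simp add: mult_ac)
  also have "\<dots> \<longleftrightarrow> \<delta>\<^sub>A * p * (exp e / sqrt (1 + u)) \<ge> \<delta>\<^sub>0 * (1 - p)"
    using n0 by (rule mult_le_cancel_right_pos)
  also have "\<dots> \<longleftrightarrow> exp e \<ge> L * sqrt (1 + u)"
    using assms u by (simp add: L_def field_simps)
  also have "\<dots> \<longleftrightarrow> e \<ge> ln (L * sqrt (1 + u))"
    using L u by (intro ln_ge_iff[symmetric] iffI) (auto simp: ln_ge_iff ln_le_cancel_iff[symmetric])
  also have "\<dots> \<longleftrightarrow> x\<^sup>2 / \<sigma>\<^sup>2 \<ge> (1 + 1 / u) * (2 * ln (L * sqrt (1 + u)))"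
  proof -
    have "1 + 1 / u = (1 + u) / u" using u by (simp add: add_divide_distrib)
    hence "(1 + 1 / u) * (u / (1 + u)) = 1" using u by simp
    hence "x\<^sup>2 / \<sigma>\<^sup>2 = x\<^sup>2 / \<sigma>\<^sup>2 * ((1 + 1 / u) * (u / (1 + u)))"
      by (simp only: mult_1_right)
    also have "\<dots> = (1 + 1 / u) * (2 * e)"
      by (simp add: e_def)
    finally have "x\<^sup>2 / \<sigma>\<^sup>2 = (1 + 1 / u) * (2 * e)" .
    moreover have "1 + 1 / u > 0" using u by (simp add: add_pos_pos)
    ultimately show ?thesis by simp
  qed
  finally show ?thesis unfolding u_def[symmetric] ln_eq by simp
qed

context two_groups
begin

lemma nu_X_measurable:
  assumes "i \<in> {1..m}"
  shows "\<nu> i \<in> M \<rightarrow>\<^sub>M count_space UNIV" "X i \<in> borel_measurable M"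
proof -
  have "(\<lambda>\<omega>. (\<nu> i \<omega>, X i \<omega>)) \<in> M \<rightarrow>\<^sub>M count_space UNIV \<Otimes>\<^sub>M borel"
    using indep assms unfolding indep_vars_def by blast
  from measurable_compose[OF this measurable_fst] measurable_compose[OF this measurable_snd]
  show "\<nu> i \<in> M \<rightarrow>\<^sub>M count_space UNIV" "X i \<in> borel_measurable M" by simp_all
qed

lemma joint_prob:
  assumes "i \<in> {1..m}" "A \<in> sets borel"
  shows "prob {\<omega> \<in> space M. X i \<omega> \<in> A \<and> \<nu> i \<omega> = 0} =
           (1 - p) * measure (density lborel (normal_density 0 \<sigma>)) A"
    and "prob {\<omega> \<in> space M. X i \<omega> \<in> A \<and> \<nu> i \<omega> = 1} =
           p * measure (density lborel (normal_density 0 (sqrt (\<sigma>\<^sup>2 + \<tau>\<^sup>2)))) A"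
  using X_null[OF assms] X_alternative[OF assms] prob_null[OF assms(1)]
    prob_alternative[OF assms(1)] p_bounds
  by (auto simp: cond_prob_def field_simps)

end

text \<open>The risk of a single test that rejects if the observation lies in \<open>A\<close>.\<close>

definition single_risk ::
  "real \<Rightarrow> real \<Rightarrow> real \<Rightarrow> real \<Rightarrow> real \<Rightarrow> real set \<Rightarrow> real" where
  "single_risk p \<sigma> \<tau> \<delta>\<^sub>0 \<delta>\<^sub>A A =
     \<delta>\<^sub>0 * (1 - p) * measure (density lborel (normal_density 0 \<sigma>)) A +
     \<delta>\<^sub>A * p * measure (density lborel (normal_density 0 (sqrt (\<sigma>\<^sup>2 + \<tau>\<^sup>2)))) (- A)"

lemma measure_normal:
  assumes "0 < s" "A \<in> sets borel"
  shows "integrable lborel (\<lambda>x. indicator A x * normal_density 0 s x)"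
    and "measure (density lborel (normal_density 0 s)) A =
           (\<integral>x. indicator A x * normal_density 0 s x \<partial>lborel)"
proof -
  show i: "integrable lborel (\<lambda>x. indicator A x * normal_density 0 s x)"
    using assms by (intro integrable_real_mult_indicator[of _ _ "normal_density 0 s", simplified mult.commute]) auto
  have "emeasure (density lborel (normal_density 0 s)) A =
      (\<integral>\<^sup>+x. ennreal (indicator A x * normal_density 0 s x) \<partial>lborel)"
    using assms by (subst emeasure_density) (auto intro!: nn_integral_cong simp: indicator_def)
  also have "\<dots> = ennreal (\<integral>x. indicator A x * normal_density 0 s x \<partial>lborel)"
    using i by (intro nn_integral_eq_integral) auto
  finally show "measure (density lborel (normal_density 0 s)) A =
           (\<integral>x. indicator A x * normal_density 0 s x \<partial>lborel)"
    by (simp add: measure_def integral_nonneg_AE)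
qed

lemma single_risk_minimal:
  assumes pos: "0 < p" "p < 1" "0 < \<sigma>" "0 < \<tau>" "0 < \<delta>\<^sub>0" "0 < \<delta>\<^sub>A" and A: "A \<in> sets borel"
  defines "B \<equiv> {x. \<delta>\<^sub>A * p * normal_density 0 (sqrt (\<sigma>\<^sup>2 + \<tau>\<^sup>2)) x \<ge>
           \<delta>\<^sub>0 * (1 - p) * normal_density 0 \<sigma> x}"
  shows "single_risk p \<sigma> \<tau> \<delta>\<^sub>0 \<delta>\<^sub>A B \<le> single_risk p \<sigma> \<tau> \<delta>\<^sub>0 \<delta>\<^sub>A A"
proof -
  have B: "B \<in> sets borel" unfolding B_def by measurable
  have s: "0 < sqrt (\<sigma>\<^sup>2 + \<tau>\<^sup>2)" using pos by (simp add: add_pos_pos)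
  let ?g = "\<lambda>A x. \<delta>\<^sub>0 * (1 - p) * (indicator A x * normal_density 0 \<sigma> x) +
     \<delta>\<^sub>A * p * (indicator (- A) x * normal_density 0 (sqrt (\<sigma>\<^sup>2 + \<tau>\<^sup>2)) x)"
  have int: "integrable lborel (?g A)" if "A \<in> sets borel" for A
    using measure_normal(1)[OF pos(3) that] measure_normal(1)[OF s, of "- A"] that by auto
  have eq: "single_risk p \<sigma> \<tau> \<delta>\<^sub>0 \<delta>\<^sub>A A = (\<integral>x. ?g A x \<partial>lborel)" if A: "A \<in> sets borel" for A
    unfolding single_risk_def
    using measure_normal[OF pos(3) A] measure_normal[OF s, of "- A"] A by simp
  show ?thesis unfolding eq[OF A] eq[OF B]
    by (rule integral_mono[OF int[OF B] int[OF A]]) (auto simp: indicator_def B_def mult_ac)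
qed

context two_groups
begin

lemma bayes_risk_eq_sum:
  assumes r: "\<And>i. i \<in> {1..m} \<Longrightarrow>
    {x \<in> space (Pi\<^sub>M {1..m} (\<lambda>_. borel)). i \<in> r x} \<in> sets (Pi\<^sub>M {1..m} (\<lambda>_. borel))"
  shows "bayes_risk M m \<nu> X \<delta>\<^sub>0 \<delta>\<^sub>A r =
    (\<Sum>i = 1..m. \<delta>\<^sub>0 * prob {\<omega> \<in> space M. i \<in> rejected m X r \<omega> \<and> \<nu> i \<omega> = 0} +
                \<delta>\<^sub>A * prob {\<omega> \<in> space M. i \<notin> rejected m X r \<omega> \<and> \<nu> i \<omega> = 1})"
proof -
  have R: "Measurable.pred M (\<lambda>\<omega>. i \<in> rejected m X r \<omega>)" if i: "i \<in> {1..m}" for i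
  proof -
    have "(\<lambda>\<omega>. \<lambda>i\<in>{1..m}. X i \<omega>) \<in> M \<rightarrow>\<^sub>M Pi\<^sub>M {1..m} (\<lambda>_. borel)"
      using nu_X_measurable by (intro measurable_restrict) auto
    moreover have "Measurable.pred (Pi\<^sub>M {1..m} (\<lambda>_. borel)) (\<lambda>x. i \<in> r x)"
      using r[OF i] by (simp add: pred_def)
    ultimately show ?thesis unfolding rejected_def by (rule measurable_compose)
  qed
  have N: "Measurable.pred M (\<lambda>\<omega>. \<nu> i \<omega> = k)" if "i \<in> {1..m}" for i k
    using nu_X_measurable(1)[OF that] by measurable
  have S: "{\<omega> \<in> space M. i \<in> rejected m X r \<omega> \<and> \<nu> i \<omega> = 0} \<in> sets M"
     "{\<omega> \<in> space M. i \<notin> rejected m X r \<omega> \<and> \<nu> i \<omega> = 1} \<in> sets M" if "i \<in> {1..m}" for i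
    using R[OF that] N[OF that] by measurable
  have card: "real (card {i \<in> {1..m}. P i}) = (\<Sum>i = 1..m. of_bool (P i))" for P
    by (simp add: of_bool_def Int_def flip: sum.inter_filter)
  have expect: "(\<integral>\<omega>. (\<Sum>i = 1..m. of_bool (P i \<omega>) :: real) \<partial>M) =
      (\<Sum>i = 1..m. prob {\<omega> \<in> space M. P i \<omega>})"
    if "\<And>i. i \<in> {1..m} \<Longrightarrow> {\<omega> \<in> space M. P i \<omega>} \<in> sets M" for P :: "nat \<Rightarrow> 'a \<Rightarrow> bool"
  proof -
    have "(\<integral>\<omega>. (\<Sum>i = 1..m. of_bool (P i \<omega>) :: real) \<partial>M) =
       (\<integral>\<omega>. (\<Sum>i = 1..m. indicator {\<omega> \<in> space M. P i \<omega>} \<omega>) \<partial>M)"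
      by (intro Bochner_Integration.integral_cong sum.cong) (auto simp: indicator_def)
    also have "\<dots> = (\<Sum>i = 1..m. prob {\<omega> \<in> space M. P i \<omega>})"
      using that by (subst Bochner_Integration.integral_sum)
        (auto simp: emeasure_eq_measure Int_absorb1 intro!: sum.cong)
    finally show ?thesis .
  qed
  have E: "(\<integral>\<omega>. (\<Sum>i = 1..m. of_bool (i \<in> rejected m X r \<omega> \<and> \<nu> i \<omega> = 0) :: real) \<partial>M) =
      (\<Sum>i = 1..m. prob {\<omega> \<in> space M. i \<in> rejected m X r \<omega> \<and> \<nu> i \<omega> = 0})"
    "(\<integral>\<omega>. (\<Sum>i = 1..m. of_bool (i \<notin> rejected m X r \<omega> \<and> \<nu> i \<omega> = 1) :: real) \<partial>M) =
      (\<Sum>i = 1..m. prob {\<omega> \<in> space M. i \<notin> rejected m X r \<omega> \<and> \<nu> i \<omega> = 1})"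
    by (rule expect, erule S)+
  show ?thesis
    unfolding bayes_risk_def false_rejections_def false_acceptances_def card E
    by (simp only: sum.distrib sum_distrib_left)
qed

lemma single_test_risk_ge:
  assumes i: "i \<in> {1..m}"
    and r: "{x \<in> space (Pi\<^sub>M {1..m} (\<lambda>_. borel)). i \<in> r x} \<in> sets (Pi\<^sub>M {1..m} (\<lambda>_. borel))"
    and c: "\<And>A. A \<in> sets borel \<Longrightarrow> c \<le> single_risk p \<sigma> \<tau> \<delta>\<^sub>0 \<delta>\<^sub>A A"
  shows "c \<le> \<delta>\<^sub>0 * prob {\<omega> \<in> space M. i \<in> rejected m X r \<omega> \<and> \<nu> i \<omega> = 0} +
                \<delta>\<^sub>A * prob {\<omega> \<in> space M. i \<notin> rejected m X r \<omega> \<and> \<nu> i \<omega> = 1}"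
proof -
  let ?N = "count_space UNIV \<Otimes>\<^sub>M borel :: (nat \<times> real) measure"
  let ?J = "{1..m} - {i}"
  let ?Q = "Pi\<^sub>M {i} (\<lambda>_. ?N)" and ?P = "Pi\<^sub>M ?J (\<lambda>_. ?N)"
  let ?W = "\<lambda>\<omega>. \<lambda>j\<in>{i}. (\<nu> j \<omega>, X j \<omega>)" and ?Y = "\<lambda>\<omega>. \<lambda>j\<in>?J. (\<nu> j \<omega>, X j \<omega>)"
  have ind: "indep_var ?Q ?W ?P ?Y"
    using i by (intro indep_var_restrict[OF indep]) auto
  note rv = indep_var_rv1[OF ind] indep_var_rv2[OF ind]
  define D1 where "D1 = distr M ?Q ?W"
  define D2 where "D2 = distr M ?P ?Y"
  interpret D1: prob_space D1 unfolding D1_def by (rule prob_space_distr) (fact rv)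
  interpret D2: prob_space D2 unfolding D2_def by (rule prob_space_distr) (fact rv)
  interpret D: pair_prob_space D1 D2 ..
  have joint: "D1 \<Otimes>\<^sub>M D2 = distr M (?Q \<Otimes>\<^sub>M ?P) (\<lambda>\<omega>. (?W \<omega>, ?Y \<omega>))"
    using ind unfolding D1_def D2_def indep_var_distribution_eq by simp
  have [measurable_cong]: "sets D1 = sets ?Q" "sets D2 = sets ?P"
    by (simp_all add: D1_def D2_def)
  define g where "g x y = (\<lambda>j\<in>{1..m}. if j = i then x else snd (y j))"
    for x :: real and y :: "nat \<Rightarrow> nat \<times> real"
  define h where "h w y = \<delta>\<^sub>0 * of_bool (i \<in> r (g (snd (w i)) y) \<and> fst (w i) = 0) +
     \<delta>\<^sub>A * of_bool (i \<notin> r (g (snd (w i)) y) \<and> fst (w i) = 1)" for w y :: "nat \<Rightarrow> nat \<times> real"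
  have comp: "(\<lambda>y. y j) \<in> ?P \<rightarrow>\<^sub>M ?N" if "j \<in> {1..m}" "j \<noteq> i" for j
    using that by (intro measurable_component_singleton) auto
  have compi: "(\<lambda>w. w i) \<in> ?Q \<rightarrow>\<^sub>M ?N"
    by (intro measurable_component_singleton) auto
  have g1: "(\<lambda>x. g x y) \<in> borel \<rightarrow>\<^sub>M Pi\<^sub>M {1..m} (\<lambda>_. borel)" for y
    unfolding g_def by (rule measurable_restrict) simp
  have upd: "(\<lambda>z. g (snd (fst z i)) (snd z)) \<in> ?Q \<Otimes>\<^sub>M ?P \<rightarrow>\<^sub>M Pi\<^sub>M {1..m} (\<lambda>_. borel)"
    unfolding g_def
  proof (rule measurable_restrict)
    fix j assume j: "j \<in> {1..m}"
    show "(\<lambda>z. if j = i then snd (fst z i) else snd (snd z j)) \<in> ?Q \<Otimes>\<^sub>M ?P \<rightarrow>\<^sub>M borel"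
      using measurable_compose[OF measurable_compose[OF measurable_fst compi] measurable_snd]
        measurable_compose[OF measurable_compose[OF measurable_snd comp[OF j]] measurable_snd]
      by (cases "j = i") simp_all
  qed
  have pr: "Measurable.pred (Pi\<^sub>M {1..m} (\<lambda>_. borel)) (\<lambda>x. i \<in> r x)"
    using r by (simp add: pred_def)
  have pr': "Measurable.pred (?Q \<Otimes>\<^sub>M ?P) (\<lambda>z. i \<in> r (g (snd (fst z i)) (snd z)))"
    by (rule measurable_compose[OF upd pr])
  have fz: "(\<lambda>z. fst (fst z i)) \<in> ?Q \<Otimes>\<^sub>M ?P \<rightarrow>\<^sub>M count_space UNIV"
    by (rule measurable_compose[OF measurable_compose[OF measurable_fst compi] measurable_fst])
  have hm: "case_prod h \<in> borel_measurable (?Q \<Otimes>\<^sub>M ?P)"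
    unfolding h_def case_prod_beta using pr' fz by measurable
  have hint: "integrable (D1 \<Otimes>\<^sub>M D2) (case_prod h)"
  proof (rule D.P.integrable_const_bound[where B = "\<bar>\<delta>\<^sub>0\<bar> + \<bar>\<delta>\<^sub>A\<bar>"])
    show "case_prod h \<in> borel_measurable (D1 \<Otimes>\<^sub>M D2)" 
      using hm unfolding joint by simp
  qed (auto simp: h_def)
  have restr: "g (X i \<omega>) (?Y \<omega>) = (\<lambda>j\<in>{1..m}. X j \<omega>)" for \<omega>
    using i by (auto simp: g_def fun_eq_iff)
  have restr': "i \<in> rejected m X r \<omega> \<longleftrightarrow> i \<in> r (g (X i \<omega>) (?Y \<omega>))" for \<omega>
    by (simp only: restr rejected_def)
  have XA: "Measurable.pred M (\<lambda>\<omega>. i \<in> rejected m X r \<omega>)"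
    using measurable_compose[OF measurable_Pair[OF rv] pr'] unfolding rejected_def restr[symmetric]
    by simp
  have nm: "\<nu> i \<in> M \<rightarrow>\<^sub>M count_space UNIV" and xm: "X i \<in> borel_measurable M"
    using nu_X_measurable[OF i] by auto
  have "(\<integral>z. case_prod h z \<partial>(D1 \<Otimes>\<^sub>M D2)) = (\<integral>\<omega>. h (?W \<omega>) (?Y \<omega>) \<partial>M)"
    unfolding joint using hm rv by (subst integral_distr) auto
  also have "\<dots> = (\<integral>\<omega>. \<delta>\<^sub>0 * indicator {\<omega> \<in> space M. i \<in> rejected m X r \<omega> \<and> \<nu> i \<omega> = 0} \<omega> +
     \<delta>\<^sub>A * indicator {\<omega> \<in> space M. i \<notin> rejected m X r \<omega> \<and> \<nu> i \<omega> = 1} \<omega> \<partial>M)"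
    by (intro Bochner_Integration.integral_cong) (auto simp: h_def restr' indicator_def)
  also have "\<dots> = \<delta>\<^sub>0 * prob {\<omega> \<in> space M. i \<in> rejected m X r \<omega> \<and> \<nu> i \<omega> = 0} +
                \<delta>\<^sub>A * prob {\<omega> \<in> space M. i \<notin> rejected m X r \<omega> \<and> \<nu> i \<omega> = 1}"
  proof -
    have "{\<omega> \<in> space M. i \<in> rejected m X r \<omega> \<and> \<nu> i \<omega> = 0} \<in> sets M"
      "{\<omega> \<in> space M. i \<notin> rejected m X r \<omega> \<and> \<nu> i \<omega> = 1} \<in> sets M"
      using XA nm by measurable
    thus ?thesis by (simp add: emeasure_eq_measure Int_absorb1)
  qed
  finally have total: "(\<integral>y. (\<integral>w. h w y \<partial>D1) \<partial>D2) = \<dots>"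
    using D.integral_snd[OF hint] by simp
  have inner: "c \<le> (\<integral>w. h w y \<partial>D1)" if y: "y \<in> space D2" for y
  proof -
    have y': "y \<in> space ?P" using y by (simp add: D2_def)
    define A where "A = {x. i \<in> r (g x y)}"
    from measurable_compose[OF g1[of y] pr] have A: "A \<in> sets borel"
      by (simp add: A_def pred_def)
    have A': "- A \<in> sets borel" using A by auto
    have "(\<integral>w. h w y \<partial>D1) = (\<integral>\<omega>. h (?W \<omega>) y \<partial>M)"
      unfolding D1_def using rv(1) measurable_compose[OF measurable_Pair2'[OF y'] hm]
      by (subst integral_distr) auto
    also have "\<dots> = (\<integral>\<omega>. \<delta>\<^sub>0 * indicator {\<omega> \<in> space M. X i \<omega> \<in> A \<and> \<nu> i \<omega> = 0} \<omega> +
       \<delta>\<^sub>A * indicator {\<omega> \<in> space M. X i \<omega> \<in> - A \<and> \<nu> i \<omega> = 1} \<omega> \<partial>M)"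
      by (intro Bochner_Integration.integral_cong) (auto simp: h_def A_def indicator_def)
    also have "\<dots> = \<delta>\<^sub>0 * prob {\<omega> \<in> space M. X i \<omega> \<in> A \<and> \<nu> i \<omega> = 0} +
                \<delta>\<^sub>A * prob {\<omega> \<in> space M. X i \<omega> \<in> - A \<and> \<nu> i \<omega> = 1}"
    proof -
      have "{\<omega> \<in> space M. X i \<omega> \<in> A \<and> \<nu> i \<omega> = 0} \<in> sets M"
        "{\<omega> \<in> space M. X i \<omega> \<in> - A \<and> \<nu> i \<omega> = 1} \<in> sets M"
        using A A' nm xm by measurable
      thus ?thesis by (simp add: emeasure_eq_measure Int_absorb1)
    qed
    also have "\<dots> = single_risk p \<sigma> \<tau> \<delta>\<^sub>0 \<delta>\<^sub>A A"
      unfolding single_risk_def joint_prob(1)[OF i A] joint_prob(2)[OF i A'] by simp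
    finally show ?thesis using c[OF A] by simp
  qed
  have "c = (\<integral>y. c \<partial>D2)" by (simp add: D2.prob_space)
  also have "\<dots> \<le> (\<integral>y. (\<integral>w. h w y \<partial>D1) \<partial>D2)"
    by (intro integral_mono D.integrable_snd hint inner) auto
  finally show ?thesis unfolding total .
qed

theorem bayes_oracle_minimizes_risk:
  assumes "0 < \<delta>\<^sub>0" "0 < \<delta>\<^sub>A"
    and r: "\<And>i. i \<in> {1..m} \<Longrightarrow>
      {x \<in> space (Pi\<^sub>M {1..m} (\<lambda>_. borel)). i \<in> r x} \<in> sets (Pi\<^sub>M {1..m} (\<lambda>_. borel))"
  shows "bayes_risk M m \<nu> X \<delta>\<^sub>0 \<delta>\<^sub>A (bayes_oracle m p \<sigma> \<tau> \<delta>\<^sub>0 \<delta>\<^sub>A) \<le> bayes_risk M m \<nu> X \<delta>\<^sub>0 \<delta>\<^sub>A r"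
proof -
  let ?o = "bayes_oracle m p \<sigma> \<tau> \<delta>\<^sub>0 \<delta>\<^sub>A"
  define B where "B = {x. \<delta>\<^sub>A * p * normal_density 0 (sqrt (\<sigma>\<^sup>2 + \<tau>\<^sup>2)) x \<ge>
           \<delta>\<^sub>0 * (1 - p) * normal_density 0 \<sigma> x}"
  have B: "B \<in> sets borel" unfolding B_def by measurable
  have B': "- B \<in> sets borel" using B by auto
  have o_iff: "i \<in> ?o x \<longleftrightarrow> x i \<in> B" if "i \<in> {1..m}" for i x
    using that unfolding bayes_oracle_def B_def
    by (simp add: oracle_iff_density[OF p_bounds sd_pos assms(1,2)])
  have meas: "{x \<in> space (Pi\<^sub>M {1..m} (\<lambda>_. borel)). i \<in> ?o x} \<in> sets (Pi\<^sub>M {1..m} (\<lambda>_. borel))"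
    if "i \<in> {1..m}" for i
    unfolding o_iff[OF that] using that B by measurable
  have sum_o: "bayes_risk M m \<nu> X \<delta>\<^sub>0 \<delta>\<^sub>A ?o =
    (\<Sum>i = 1..m. \<delta>\<^sub>0 * prob {\<omega> \<in> space M. i \<in> rejected m X ?o \<omega> \<and> \<nu> i \<omega> = 0} +
                \<delta>\<^sub>A * prob {\<omega> \<in> space M. i \<notin> rejected m X ?o \<omega> \<and> \<nu> i \<omega> = 1})"
    by (rule bayes_risk_eq_sum, erule meas)
  have sum_r: "bayes_risk M m \<nu> X \<delta>\<^sub>0 \<delta>\<^sub>A r =
    (\<Sum>i = 1..m. \<delta>\<^sub>0 * prob {\<omega> \<in> space M. i \<in> rejected m X r \<omega> \<and> \<nu> i \<omega> = 0} +
                \<delta>\<^sub>A * prob {\<omega> \<in> space M. i \<notin> rejected m X r \<omega> \<and> \<nu> i \<omega> = 1})"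
    by (rule bayes_risk_eq_sum, erule r)
  show ?thesis
    unfolding sum_o sum_r
  proof (rule sum_mono)
    fix i assume i: "i \<in> {1..m}"
    have rej: "i \<in> rejected m X ?o \<omega> \<longleftrightarrow> X i \<omega> \<in> B" "i \<notin> rejected m X ?o \<omega> \<longleftrightarrow> X i \<omega> \<in> - B" for \<omega>
      using i by (auto simp: rejected_def o_iff)
    have "\<delta>\<^sub>0 * prob {\<omega> \<in> space M. i \<in> rejected m X ?o \<omega> \<and> \<nu> i \<omega> = 0} +
          \<delta>\<^sub>A * prob {\<omega> \<in> space M. i \<notin> rejected m X ?o \<omega> \<and> \<nu> i \<omega> = 1} =
          single_risk p \<sigma> \<tau> \<delta>\<^sub>0 \<delta>\<^sub>A B"
      unfolding rej(2) unfolding rej(1) joint_prob(1)[OF i B] joint_prob(2)[OF i B'] single_risk_def by simp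
    also have "\<dots> \<le> \<delta>\<^sub>0 * prob {\<omega> \<in> space M. i \<in> rejected m X r \<omega> \<and> \<nu> i \<omega> = 0} +
          \<delta>\<^sub>A * prob {\<omega> \<in> space M. i \<notin> rejected m X r \<omega> \<and> \<nu> i \<omega> = 1}"
      by (rule single_test_risk_ge[OF i r[OF i]], unfold B_def,
          rule single_risk_minimal[OF p_bounds sd_pos assms(1,2)])
    finally show "\<delta>\<^sub>0 * prob {\<omega> \<in> space M. i \<in> rejected m X ?o \<omega> \<and> \<nu> i \<omega> = 0} +
          \<delta>\<^sub>A * prob {\<omega> \<in> space M. i \<notin> rejected m X ?o \<omega> \<and> \<nu> i \<omega> = 1} \<le> \<dots>" .
  qed
qed

end

definition p_value :: "real \<Rightarrow> real \<Rightarrow> real" where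
  "p_value \<sigma> x = 2 * (1 - cdf std_normal_distribution (\<bar>x\<bar> / \<sigma>))"

text \<open>The \<open>i\<close>-th smallest of the \<open>m\<close> \<open>p\<close>-values, \<open>i \<in> {1..m}\<close>, counted with multiplicity.\<close>

definition ordered_p_value :: "nat \<Rightarrow> real \<Rightarrow> (nat \<Rightarrow> real) \<Rightarrow> nat \<Rightarrow> real" where
  "ordered_p_value m \<sigma> x i = sort (map (\<lambda>j. p_value \<sigma> (x j)) [1..<Suc m]) ! (i - 1)"

definition BH_rule :: "nat \<Rightarrow> real \<Rightarrow> real \<Rightarrow> testing_rule" where
  "BH_rule m \<sigma> \<alpha> x =
     (let K = {i \<in> {1..m}. ordered_p_value m \<sigma> x i \<le> real i * \<alpha> / real m}
      in if K = {} then {}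
         else {j \<in> {1..m}. p_value \<sigma> (x j) \<le> ordered_p_value m \<sigma> x (Max K)})"

definition ABOS :: "(nat \<Rightarrow> real) \<Rightarrow> (nat \<Rightarrow> real) \<Rightarrow> bool" where
  "ABOS R R_opt \<longleftrightarrow> (\<lambda>m. R m / R_opt m) \<longlonglongrightarrow> 1"

definition seq_propto :: "(nat \<Rightarrow> real) \<Rightarrow> (nat \<Rightarrow> real) \<Rightarrow> bool" where
  "seq_propto a b \<longleftrightarrow> (\<exists>c>0. (\<lambda>m. a m / b m) \<longlonglongrightarrow> c)"

end

theory Submission
  imports Defs "HOL-Real_Asymp.Real_Asymp"
begin

text \<open>
  Write \<open>Z\<close> for a standard normal variable and \<open>a = P(\<bar>Z\<bar> \<le> sqrt C)\<close>, where \<open>0 < a < 1\<close>. Both risks are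
  asymptotic to \<open>\<delta>\<^sub>A m p a\<close>.

  The oracle misses a given signal with probability tending to \<open>a\<close>, because its squared cutoff divided
  by \<open>\<sigma>\<^sup>2 + \<tau>\<^sup>2\<close> tends to \<open>C\<close>; hence its risk is at least \<open>(1 - o(1)) \<delta>\<^sub>A m p a\<close>
  (\<open>bayes_risk_oracle_ge\<close>). As the oracle minimizes the risk, only an upper bound of the same order is
  needed for the Benjamini-Hochberg procedure.

  The procedure is used through two consequences of its definition. It is self-consistent: a rejected
  \<open>p\<close>-value is at most \<open>|R| \<alpha> / m\<close>, with \<open>R\<close> the set of rejections (\<open>BH_rule_self_consistent\<close>). And it
  rejects every \<open>p\<close>-value up to \<open>t\<close> as soon as there are at least \<open>m t / \<alpha>\<close> of them
  (\<open>BH_rule_rejects_below\<close>).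

  Type I errors. Let \<open>V\<close> be the number of false rejections and \<open>S\<close> the number of signals. If
  \<open>V > \<epsilon> S\<close>, then \<open>|R| \<le> (1 + 1/\<epsilon>) V\<close>, so by self-consistency at least \<open>V\<close> true nulls have a \<open>p\<close>-value
  of at most \<open>c V / m\<close>, with \<open>c = \<alpha> (1 + 1/\<epsilon>)\<close>. By a union bound over
  subsets, at least \<open>w\<close> nulls have a \<open>p\<close>-value of at most \<open>c w / m\<close> with probability at most \<open>(m choose w) (c w / m)\<^sup>w \<le> (c e)\<^sup>w\<close>. Summation over \<open>w\<close> gives
  \<open>E V \<le> \<epsilon> m p + 4 c e\<close> for small \<open>c\<close>, and \<open>\<epsilon> = sqrt \<alpha>\<close> makes this \<open>o(m p)\<close>, as \<open>\<alpha>\<close> tends to \<open>0\<close> while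
  \<open>m p\<close> stays bounded away from \<open>0\<close> because of \<open>\<beta> \<le> 1\<close>.

  Type II errors. A signal \<open>X\<close> with \<open>\<bar>X\<bar> \<ge> \<sigma> sqrt (2 log (2/t))\<close> has a \<open>p\<close>-value of at most \<open>t\<close>. For \<open>\<beta> = 1\<close> take the
  Bonferroni cutoff \<open>t = \<alpha> / m\<close>, up to which everything is rejected. For \<open>\<beta> < 1\<close> take
  \<open>t = \<alpha> \<kappa> p\<close> with a small constant \<open>\<kappa>\<close>: the number of signals beyond the corresponding cutoff
  exceeds \<open>\<kappa> m p\<close> except with exponentially small probability in \<open>m p\<close>, which tends to infinity. The limit of \<open>log v / u\<close>
  gives \<open>- 2 log p / u \<longrightarrow> C\<close>, and \<open>log \<alpha> = o(log m)\<close> makes \<open>\<alpha>\<close> negligible on this scale, so in both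
  cases \<open>2 log (2/t) / (1 + u) \<longrightarrow> C\<close> and a signal is missed with probability at most \<open>a + o(1)\<close>.
\<close>

section \<open>The normal distribution and \<open>p\<close>-values\<close>

interpretation std_normal: real_distribution std_normal_distribution
  by (rule real_dist_normal_dist)

text \<open>
  The probability that a standard normal variable lies in \<open>[- y, y]\<close>; it is only meaningful for
  \<open>y \<ge> 0\<close>.
\<close>
definition central_mass :: "real \<Rightarrow> real" where
  "central_mass y = cdf std_normal_distribution y - cdf std_normal_distribution (- y)"

text \<open>
  Allowing \<open>c = - s\<close> besides \<open>c = s\<close> also yields the symmetry of the normal distribution.
\<close>
lemma measure_normal_scale:
  assumes s: "0 < s" and c: "\<bar>c\<bar> = s" and A: "A \<in> sets borel"
  shows "measure (density lborel (normal_density 0 s)) A =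
    measure std_normal_distribution {x. c * x \<in> A}"
proof -
  have c0: "c \<noteq> 0" using s c by auto
  have c2: "c\<^sup>2 = s\<^sup>2" using c by (metis power2_abs)
  have A': "{x. c * x \<in> A} \<in> sets borel" using A by measurable
  have nd: "s * normal_density 0 s (c * x) = normal_density 0 1 x" for x
    using s by (simp add: normal_density_def power_mult_distrib c2 real_sqrt_mult)
  have "measure (density lborel (normal_density 0 s)) A =
      (\<integral>x. indicator A x * normal_density 0 s x \<partial>lborel)"
    by (rule measure_normal(2)[OF s A])
  also have "\<dots> = \<bar>c\<bar> *\<^sub>R (\<integral>x. indicator A (0 + c * x) * normal_density 0 s (0 + c * x) \<partial>lborel)"
    by (rule lborel_integral_real_affine[OF c0])
  also have "\<dots> = (\<integral>x. indicator {x. c * x \<in> A} x * normal_density 0 1 x \<partial>lborel)"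
    unfolding c nd[symmetric] by (simp add: indicator_def mult_ac flip: integral_mult_right_zero)
  also have "\<dots> = measure std_normal_distribution {x. c * x \<in> A}"
    by (rule measure_normal(2)[OF _ A', symmetric]) simp
  finally show ?thesis .
qed

lemma measure_std_normal_singleton: "measure std_normal_distribution {x} = 0"
proof -
  have "AE y in lborel. indicator {x} y * normal_density 0 1 y = 0"
    using AE_lborel_singleton[of x] by eventually_elim auto
  hence "(\<integral>y. indicator {x} y * normal_density 0 1 y \<partial>lborel) = 0"
    by (rule integral_eq_zero_AE)
  thus ?thesis using measure_normal(2)[of 1 "{x}"] by simp
qed

lemma isCont_cdf_std_normal: "isCont (cdf std_normal_distribution) x"
  by (simp add: std_normal.isCont_cdf measure_std_normal_singleton)

lemma isCont_central_mass: "isCont central_mass y"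
  unfolding central_mass_def
  by (intro continuous_intros isCont_o2[OF _ isCont_cdf_std_normal] isCont_cdf_std_normal)

lemma cdf_std_normal_minus: "cdf std_normal_distribution (- z) = 1 - cdf std_normal_distribution z"
proof -
  have "cdf std_normal_distribution (- z) = measure std_normal_distribution {x. (- 1) * x \<in> {..- z}}"
    unfolding cdf_def by (rule measure_normal_scale) auto
  also have "{x. (- 1) * x \<in> {..- z}} = {z..}" by auto
  also have "measure std_normal_distribution {z..} = measure std_normal_distribution {z<..}"
  proof -
    have "{z..} = {z<..} \<union> {z}" by auto
    thus ?thesis using std_normal.finite_measure_Union[of "{z<..}" "{z}"]
      by (simp add: measure_std_normal_singleton)
  qed
  also have "\<dots> = 1 - cdf std_normal_distribution z"
    using std_normal.prob_compl[of "{..z}"] by (simp add: cdf_def Compl_eq_Diff_UNIV[symmetric])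
  finally show ?thesis .
qed

lemma cdf_std_normal_less:
  assumes "a < b"
  shows "cdf std_normal_distribution a < cdf std_normal_distribution b"
proof -
  define r where "r = max \<bar>a\<bar> \<bar>b\<bar>"
  have le: "normal_density 0 1 r \<le> normal_density 0 1 x" if "x \<in> {a<..b}" for x
  proof -
    have "x\<^sup>2 \<le> r\<^sup>2" using that by (intro abs_le_square_iff[THEN iffD1]) (auto simp: r_def)
    thus ?thesis by (simp add: normal_density_def divide_right_mono)
  qed
  have "0 < (b - a) * normal_density 0 1 r"
    using assms by (simp add: normal_density_pos)
  also have "\<dots> = (\<integral>x. indicator {a<..b} x * normal_density 0 1 r \<partial>lborel)"
    using assms by simp
  also have "\<dots> \<le> (\<integral>x. indicator {a<..b} x * normal_density 0 1 x \<partial>lborel)"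
  proof (rule integral_mono)
    show "integrable lborel (\<lambda>x. indicator {a<..b} x * normal_density 0 1 r)"
      using assms by (intro integrable_mult_left integrable_real_indicator) auto
    show "integrable lborel (\<lambda>x. indicator {a<..b} x * normal_density 0 1 x)"
      by (rule measure_normal(1)) auto
    show "indicator {a<..b} x * normal_density 0 1 r \<le> indicator {a<..b} x * normal_density 0 1 x" for x
      using le[of x] by (cases "x \<in> {a<..b}") auto
  qed
  also have "\<dots> = measure std_normal_distribution {a<..b}"
    using measure_normal(2)[of 1 "{a<..b}"] by simp
  also have "\<dots> = cdf std_normal_distribution b - cdf std_normal_distribution a"
    using std_normal.cdf_diff_eq[OF assms] by simp
  finally show ?thesis by simp
qed

lemma central_mass_pos: "0 < y \<Longrightarrow> 0 < central_mass y"
  using cdf_std_normal_less[of "- y" y] by (simp add: central_mass_def)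

lemma central_mass_less_1: "central_mass y < 1"
  using cdf_std_normal_less[of y "y + 1"] std_normal.cdf_bounded_prob[of "y + 1"]
    std_normal.cdf_nonneg[of "- y"] by (simp add: central_mass_def)

lemma central_mass_nonneg: "0 \<le> y \<Longrightarrow> 0 \<le> central_mass y"
  using central_mass_pos[of y] by (cases "y = 0") (auto simp: central_mass_def)

lemma measure_normal_central:
  assumes s: "0 < s" and y: "0 \<le> y"
  shows "measure (density lborel (normal_density 0 s)) {x. \<bar>x\<bar> < s * y} = central_mass y"
proof -
  have "measure (density lborel (normal_density 0 s)) {x. \<bar>x\<bar> < s * y} =
      measure std_normal_distribution {x. s * x \<in> {x. \<bar>x\<bar> < s * y}}"
    using s by (intro measure_normal_scale) auto
  also have "{x. s * x \<in> {x. \<bar>x\<bar> < s * y}} = {- y<..<y}"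
    using s by (auto simp: abs_mult)
  also have "measure std_normal_distribution {- y<..<y} = central_mass y"
  proof (cases "y = 0")
    case False
    hence "{- y<..y} = {- y<..<y} \<union> {y}" using y by auto
    hence "measure std_normal_distribution {- y<..y} = measure std_normal_distribution {- y<..<y}"
      using std_normal.finite_measure_Union[of "{- y<..<y}" "{y}"]
      by (simp add: measure_std_normal_singleton)
    thus ?thesis using std_normal.cdf_diff_eq[of "- y" y] y False by (simp add: central_mass_def)
  qed (simp add: central_mass_def)
  finally show ?thesis .
qed

lemma measure_normal_compl:
  assumes s: "0 < s" and A: "A \<in> sets borel"
  shows "measure (density lborel (normal_density 0 s)) (- A) =
    1 - measure (density lborel (normal_density 0 s)) A"
proof -
  interpret N: prob_space "density lborel (normal_density 0 s)"
    by (rule prob_space_normal_density[OF s])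
  show ?thesis using N.prob_compl[of A] A by (simp add: Compl_eq_Diff_UNIV)
qed

lemma measure_normal_tails:
  assumes s: "0 < s" and y: "0 \<le> y"
  shows "measure (density lborel (normal_density 0 s)) {x. s * y \<le> \<bar>x\<bar>} = 1 - central_mass y"
proof -
  have "{x. s * y \<le> \<bar>x\<bar>} = - {x. \<bar>x\<bar> < s * y}" by auto
  moreover have "{x. \<bar>x\<bar> < s * y} \<in> sets borel" by measurable
  ultimately show ?thesis using measure_normal_compl[OF s] measure_normal_central[OF s y] by simp
qed

lemma std_normal_tail_le:
  assumes z: "0 \<le> z"
  shows "1 - cdf std_normal_distribution z \<le> exp (- (z\<^sup>2 / 2))"
proof -
  \<comment> \<open>Beyond \<open>z\<close>, the standard density is at most \<open>exp (- z\<^sup>2 / 2)\<close> times the density centred at \<open>z\<close>.\<close>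
  have le: "indicator {z<..} x * normal_density 0 1 x \<le> exp (- (z\<^sup>2 / 2)) * normal_density z 1 x" for x
  proof (cases "z < x")
    case True
    hence "z\<^sup>2 + (x - z)\<^sup>2 \<le> x\<^sup>2"
      using mult_nonneg_nonneg[OF z, of "x - z"] by (simp add: power2_eq_square algebra_simps)
    hence "- (x\<^sup>2 / 2) \<le> - (z\<^sup>2 / 2) + - ((x - z)\<^sup>2 / 2)" by simp
    hence "exp (- (x\<^sup>2 / 2)) \<le> exp (- (z\<^sup>2 / 2)) * exp (- ((x - z)\<^sup>2 / 2))"
      unfolding exp_add[symmetric] by simp
    thus ?thesis using True by (simp add: normal_density_def divide_right_mono)
  qed auto
  have "1 - cdf std_normal_distribution z = measure std_normal_distribution {z<..}"
    using std_normal.prob_compl[of "{..z}"] by (simp add: cdf_def Compl_eq_Diff_UNIV[symmetric])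
  also have "\<dots> = (\<integral>x. indicator {z<..} x * normal_density 0 1 x \<partial>lborel)"
    using measure_normal(2)[of 1 "{z<..}"] by simp
  also have "\<dots> \<le> (\<integral>x. exp (- (z\<^sup>2 / 2)) * normal_density z 1 x \<partial>lborel)"
    using le by (intro integral_mono measure_normal(1)) auto
  also have "\<dots> = exp (- (z\<^sup>2 / 2))" by simp
  finally show ?thesis .
qed

lemma p_value_measurable [measurable]: "p_value \<sigma> \<in> borel_measurable borel"
proof -
  have "cdf std_normal_distribution \<in> borel_measurable borel"
    by (intro borel_measurable_continuous_onI continuous_at_imp_continuous_on ballI
        isCont_cdf_std_normal)
  thus ?thesis unfolding p_value_def[abs_def] by measurable
qed

text \<open>
  A lower bound on \<open>\<bar>x\<bar>\<close> that forces the \<open>p\<close>-value down to \<open>t\<close>; to first order as \<open>t\<close> tends to \<open>0\<close>,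
  it is the exact cutoff.
\<close>
lemma p_value_le_of_large:
  assumes \<sigma>: "0 < \<sigma>" and t: "0 < t" "t \<le> 2" and x: "\<sigma> * sqrt (2 * ln (2 / t)) \<le> \<bar>x\<bar>"
  shows "p_value \<sigma> x \<le> t"
proof -
  define z where "z = \<bar>x\<bar> / \<sigma>"
  have l: "0 \<le> ln (2 / t)" using t by simp
  have z: "sqrt (2 * ln (2 / t)) \<le> z" using x \<sigma> by (simp add: z_def field_simps)
  have "0 \<le> sqrt (2 * ln (2 / t))" using l by simp
  hence z0: "0 \<le> z" using z by linarith
  have "2 * ln (2 / t) \<le> z\<^sup>2" using z z0 l by (metis real_sqrt_le_iff real_sqrt_unique)
  hence "exp (- (z\<^sup>2 / 2)) \<le> exp (- ln (2 / t))" by simp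
  also have "\<dots> = t / 2" using t by (simp add: exp_minus)
  finally show ?thesis using std_normal_tail_le[OF z0] by (simp add: p_value_def z_def)
qed

text \<open>
  Under the null hypothesis the \<open>p\<close>-value is uniformly distributed; only the upper bound is needed.
\<close>
lemma null_p_value_le:
  assumes \<sigma>: "0 < \<sigma>" and t: "0 < t"
  shows "measure (density lborel (normal_density 0 \<sigma>)) {x. p_value \<sigma> x \<le> t} \<le> t"
proof -
  interpret N: prob_space "density lborel (normal_density 0 \<sigma>)"
    by (rule prob_space_normal_density[OF \<sigma>])
  let ?F = "cdf std_normal_distribution"
  show ?thesis
  proof (cases "t \<ge> 1")
    case True
    thus ?thesis using N.prob_le_1 by (rule order_trans[rotated])
  next
    case False
    \<comment> \<open>\<open>Inf S\<close> is the upper \<open>t/2\<close>-quantile of the standard normal distribution.\<close>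
    define S where "S = {z. 0 \<le> z \<and> 1 - t / 2 \<le> ?F z}"
    have "continuous_on UNIV ?F"
      by (intro continuous_at_imp_continuous_on ballI isCont_cdf_std_normal)
    hence "closed S" unfolding S_def
      by (intro closed_Collect_conj closed_Collect_le) (auto intro: continuous_intros)
    moreover have "S \<noteq> {}"
    proof -
      have "eventually (\<lambda>z. 1 - t / 2 < ?F z) at_top"
        using std_normal.cdf_lim_at_top_prob t by (intro order_tendstoD) auto
      with eventually_ge_at_top[of 0] have "eventually (\<lambda>z. z \<in> S) at_top"
        by eventually_elim (auto simp: S_def)
      thus ?thesis by (metis empty_iff eventually_happens trivial_limit_at_top_linorder)
    qed
    moreover have bdd: "bdd_below S" by (intro bdd_belowI[of _ 0]) (auto simp: S_def)
    ultimately have InfS: "Inf S \<in> S" by (intro closed_contains_Inf)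
    have "{x. p_value \<sigma> x \<le> t} \<subseteq> {x. \<sigma> * Inf S \<le> \<bar>x\<bar>}"
    proof safe
      fix x assume "p_value \<sigma> x \<le> t"
      hence "\<bar>x\<bar> / \<sigma> \<in> S" using \<sigma> by (auto simp: S_def p_value_def)
      hence "Inf S \<le> \<bar>x\<bar> / \<sigma>" by (rule cInf_lower[OF _ bdd])
      thus "\<sigma> * Inf S \<le> \<bar>x\<bar>" using \<sigma> by (simp add: field_simps)
    qed
    hence "measure (density lborel (normal_density 0 \<sigma>)) {x. p_value \<sigma> x \<le> t} \<le>
        measure (density lborel (normal_density 0 \<sigma>)) {x. \<sigma> * Inf S \<le> \<bar>x\<bar>}"
      by (intro N.finite_measure_mono) auto
    also have "\<dots> = 2 * (1 - ?F (Inf S))"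
      using measure_normal_tails[OF \<sigma>, of "Inf S"] InfS cdf_std_normal_minus[of "Inf S"]
      by (simp add: S_def central_mass_def)
    also have "\<dots> \<le> t" using InfS by (simp add: S_def)
    finally show ?thesis .
  qed
qed

section \<open>The Benjamini-Hochberg procedure on fixed data\<close>

lemma card_filter_nth:
  "card {j \<in> {1..m}. P (g j)} = length (filter P (map g [1..<Suc m]))"
proof -
  have "length (filter P (map g [1..<Suc m])) = length (filter (P \<circ> g) [1..<Suc m])"
    by (simp add: filter_map)
  also have "\<dots> = card (set (filter (P \<circ> g) [1..<Suc m]))"
    by (intro distinct_card[symmetric]) auto
  also have "set (filter (P \<circ> g) [1..<Suc m]) = {j \<in> {1..m}. P (g j)}"
    by auto
  finally show ?thesis by simp
qed

lemma sorted_nth_le_iff: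
  fixes xs :: "'a::linorder list"
  assumes "sorted xs" "k < length xs"
  shows "xs ! k \<le> t \<longleftrightarrow> Suc k \<le> length (filter (\<lambda>x. x \<le> t) xs)"
proof -
  define n where "n = length (filter (\<lambda>x. x \<le> t) xs)"
  have n: "n = card {i. i < length xs \<and> xs ! i \<le> t}"
    by (simp add: n_def length_filter_conv_card)
  show ?thesis
  proof
    assume "xs ! k \<le> t"
    hence "{..k} \<subseteq> {i. i < length xs \<and> xs ! i \<le> t}"
      using assms by (auto dest: sorted_nth_mono[of xs _ k])
    from card_mono[OF _ this] show "Suc k \<le> length (filter (\<lambda>x. x \<le> t) xs)"
      by (simp add: n_def[symmetric] n)
  next
    assume *: "Suc k \<le> length (filter (\<lambda>x. x \<le> t) xs)"
    show "xs ! k \<le> t"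
    proof (rule ccontr)
      assume "\<not> xs ! k \<le> t"
      hence "i < k" if "i < length xs" "xs ! i \<le> t" for i
        using that assms sorted_nth_mono[of xs k i] by (meson leI order_trans)
      hence "{i. i < length xs \<and> xs ! i \<le> t} \<subseteq> {..<k}" by auto
      from card_mono[OF _ this] show False using * by (simp add: n_def[symmetric] n)
    qed
  qed
qed

lemma ordered_p_value_le_iff:
  assumes "k \<in> {1..m}"
  shows "ordered_p_value m \<sigma> x k \<le> t \<longleftrightarrow> k \<le> card {j \<in> {1..m}. p_value \<sigma> (x j) \<le> t}"
proof -
  let ?xs = "map (\<lambda>j. p_value \<sigma> (x j)) [1..<Suc m]"
  have "mset (filter (\<lambda>y. y \<le> t) (sort ?xs)) = mset (filter (\<lambda>y. y \<le> t) ?xs)"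
    by (simp only: mset_filter mset_sort)
  hence len: "length (filter (\<lambda>y. y \<le> t) (sort ?xs)) = length (filter (\<lambda>y. y \<le> t) ?xs)"
    by (rule mset_eq_length)
  have "ordered_p_value m \<sigma> x k \<le> t \<longleftrightarrow> Suc (k - 1) \<le> length (filter (\<lambda>y. y \<le> t) (sort ?xs))"
    unfolding ordered_p_value_def using assms by (intro sorted_nth_le_iff) auto
  thus ?thesis using assms unfolding len card_filter_nth[of m "\<lambda>y. y \<le> t" "\<lambda>j. p_value \<sigma> (x j)"]
    by simp
qed

lemma le_ordered_p_value_card:
  assumes i: "i \<in> {1..m}" and le: "p_value \<sigma> (x i) \<le> t"
  shows "p_value \<sigma> (x i) \<le> ordered_p_value m \<sigma> x (card {j \<in> {1..m}. p_value \<sigma> (x j) \<le> t})"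
proof (rule ccontr)
  define N where "N t = {j \<in> {1..m}. p_value \<sigma> (x j) \<le> t}" for t
  define t' where "t' = ordered_p_value m \<sigma> x (card (N t))"
  assume "\<not> ?thesis"
  hence less: "t' < p_value \<sigma> (x i)" by (simp add: t'_def N_def)
  have fin: "finite (N t)" for t by (simp add: N_def)
  have "card (N t) \<le> card {1..m}" by (intro card_mono) (auto simp: N_def)
  moreover have "N t \<noteq> {}" using i le by (auto simp: N_def)
  ultimately have k: "card (N t) \<in> {1..m}" using fin[of t] by (auto simp: Suc_le_eq card_gt_0_iff)
  have "card (N t) \<le> card (N t')"
    using ordered_p_value_le_iff[OF k, of \<sigma> x t'] by (simp add: t'_def N_def)
  moreover have "N t' \<subseteq> N t" using le less by (auto simp: N_def)
  moreover have "i \<in> N t" "i \<notin> N t'" using i le less by (auto simp: N_def)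
  ultimately have "card (N t) \<le> card (N t')" "N t' \<subset> N t" by auto
  from this(1) psubset_card_mono[OF fin this(2)] show False by simp
qed

text \<open>
  A description of the procedure by counts instead of order statistics, from which its measurability and
  the two properties below follow.
\<close>
lemma mem_BH_rule_iff:
  assumes \<alpha>: "0 \<le> \<alpha>"
  shows "i \<in> BH_rule m \<sigma> \<alpha> x \<longleftrightarrow> i \<in> {1..m} \<and>
    (\<exists>k\<in>{1..m}. p_value \<sigma> (x i) \<le> real k * \<alpha> / real m \<and>
       k \<le> card {j \<in> {1..m}. p_value \<sigma> (x j) \<le> real k * \<alpha> / real m})"
proof -
  define N where "N t = {j \<in> {1..m}. p_value \<sigma> (x j) \<le> t}" for t
  define K where "K = {k \<in> {1..m}. ordered_p_value m \<sigma> x k \<le> real k * \<alpha> / real m}"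
  have K: "k \<in> K \<longleftrightarrow> k \<in> {1..m} \<and> k \<le> card (N (real k * \<alpha> / real m))" for k
    unfolding K_def N_def using ordered_p_value_le_iff[of k m \<sigma> x] by auto
  have finK: "finite K" by (simp add: K_def)
  have BH: "BH_rule m \<sigma> \<alpha> x =
    (if K = {} then {} else {j \<in> {1..m}. p_value \<sigma> (x j) \<le> ordered_p_value m \<sigma> x (Max K)})"
    unfolding BH_rule_def K_def Let_def by (rule refl)
  show ?thesis
  proof
    assume i: "i \<in> BH_rule m \<sigma> \<alpha> x"
    hence "K \<noteq> {}" by (auto simp: BH split: if_splits)
    hence MK: "Max K \<in> K" using finK by (intro Max_in)
    hence "Max K \<in> {1..m}" "Max K \<le> card (N (real (Max K) * \<alpha> / real m))"
      using K by auto
    moreover have "i \<in> {1..m}" "p_value \<sigma> (x i) \<le> ordered_p_value m \<sigma> x (Max K)"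
      using i \<open>K \<noteq> {}\<close> by (auto simp: BH)
    moreover have "ordered_p_value m \<sigma> x (Max K) \<le> real (Max K) * \<alpha> / real m"
      using MK unfolding K_def by blast
    ultimately show "i \<in> {1..m} \<and> (\<exists>k\<in>{1..m}. p_value \<sigma> (x i) \<le> real k * \<alpha> / real m \<and>
       k \<le> card {j \<in> {1..m}. p_value \<sigma> (x j) \<le> real k * \<alpha> / real m})"
      unfolding N_def by (meson order_trans)
  next
    assume "i \<in> {1..m} \<and> (\<exists>k\<in>{1..m}. p_value \<sigma> (x i) \<le> real k * \<alpha> / real m \<and>
       k \<le> card {j \<in> {1..m}. p_value \<sigma> (x j) \<le> real k * \<alpha> / real m})"
    then obtain k where i: "i \<in> {1..m}" and k: "k \<in> {1..m}" and le: "p_value \<sigma> (x i) \<le> real k * \<alpha> / real m"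
      and kN: "k \<le> card (N (real k * \<alpha> / real m))" by (auto simp: N_def)
    define t where "t = real k * \<alpha> / real m"
    define n where "n = card (N t)"
    have n: "n \<in> {1..m}"
    proof -
      have "n \<le> card {1..m}" unfolding n_def by (intro card_mono) (auto simp: N_def)
      thus ?thesis using k kN by (simp add: n_def t_def)
    qed
    have tn: "t \<le> real n * \<alpha> / real m"
      unfolding t_def using kN \<alpha> by (intro divide_right_mono mult_right_mono) (auto simp: n_def t_def)
    \<comment> \<open>The number \<open>n \<ge> k\<close> of \<open>p\<close>-values below the \<open>k\<close>-th cutoff belongs to \<open>K\<close> as well.\<close>
    have on: "ordered_p_value m \<sigma> x n \<le> t"
      using ordered_p_value_le_iff[OF n, of \<sigma> x t] by (simp add: n_def N_def)
    hence nK: "n \<in> K" using n tn by (simp add: K_def)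
    hence ne: "K \<noteq> {}" by auto
    have nM: "n \<le> Max K" using finK nK by simp
    have MK: "Max K \<in> K" using finK ne by (rule Max_in)
    have "p_value \<sigma> (x i) \<le> ordered_p_value m \<sigma> x n"
      unfolding n_def N_def using i le by (intro le_ordered_p_value_card) (auto simp: t_def)
    also have "\<dots> \<le> ordered_p_value m \<sigma> x (Max K)"
      unfolding ordered_p_value_def using nM n MK
      by (intro sorted_nth_mono) (auto simp: K_def)
    finally show "i \<in> BH_rule m \<sigma> \<alpha> x" using ne i by (simp add: BH)
  qed
qed

lemma BH_rule_subset: "BH_rule m \<sigma> \<alpha> x \<subseteq> {1..m}"
  by (auto simp: BH_rule_def Let_def split: if_splits)

lemma BH_rule_rejects_below:
  assumes \<alpha>: "0 < \<alpha>" and i: "i \<in> {1..m}" "p_value \<sigma> (x i) \<le> t"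
    and N: "real m * t / \<alpha> \<le> real (card {j \<in> {1..m}. p_value \<sigma> (x j) \<le> t})"
  shows "i \<in> BH_rule m \<sigma> \<alpha> x"
proof -
  define n where "n = card {j \<in> {1..m}. p_value \<sigma> (x j) \<le> t}"
  have "n \<noteq> 0" using i by (auto simp: n_def)
  moreover have "n \<le> card {1..m}" unfolding n_def by (intro card_mono) auto
  ultimately have n: "n \<in> {1..m}" by simp
  have tn: "t \<le> real n * \<alpha> / real m"
    using N n \<alpha> unfolding n_def[symmetric] by (simp add: field_simps)
  hence "card {j \<in> {1..m}. p_value \<sigma> (x j) \<le> t} \<le>
      card {j \<in> {1..m}. p_value \<sigma> (x j) \<le> real n * \<alpha> / real m}"
    by (intro card_mono) auto
  thus ?thesis using i n tn \<alpha> unfolding mem_BH_rule_iff[OF less_imp_le[OF \<alpha>]]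
    by (intro conjI bexI[of _ n]) (auto simp only: n_def[symmetric])
qed

text \<open>
  In particular, with \<open>V\<close> false rejections and \<open>S\<close> signals all rejected \<open>p\<close>-values are at most
  \<open>(V + S) \<alpha> / m\<close>.
\<close>
lemma BH_rule_self_consistent:
  assumes \<alpha>: "0 \<le> \<alpha>" and i: "i \<in> BH_rule m \<sigma> \<alpha> x"
  shows "p_value \<sigma> (x i) \<le> real (card (BH_rule m \<sigma> \<alpha> x)) * \<alpha> / real m"
proof -
  obtain k where k: "k \<in> {1..m}" "p_value \<sigma> (x i) \<le> real k * \<alpha> / real m"
    and card: "k \<le> card {j \<in> {1..m}. p_value \<sigma> (x j) \<le> real k * \<alpha> / real m}"
    using i \<alpha> by (auto simp: mem_BH_rule_iff)
  have "{j \<in> {1..m}. p_value \<sigma> (x j) \<le> real k * \<alpha> / real m} \<subseteq> BH_rule m \<sigma> \<alpha> x"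
  proof
    fix j assume "j \<in> {j \<in> {1..m}. p_value \<sigma> (x j) \<le> real k * \<alpha> / real m}"
    thus "j \<in> BH_rule m \<sigma> \<alpha> x" unfolding mem_BH_rule_iff[OF \<alpha>] using k(1) card by blast
  qed
  hence "k \<le> card (BH_rule m \<sigma> \<alpha> x)"
    using card card_mono[OF finite_subset[OF BH_rule_subset]] by (meson finite_atLeastAtMost le_trans)
  hence "real k * \<alpha> / real m \<le> real (card (BH_rule m \<sigma> \<alpha> x)) * \<alpha> / real m"
    using \<alpha> by (intro divide_right_mono mult_right_mono) auto
  thus ?thesis using k by linarith
qed

lemma BH_rule_measurable:
  assumes \<alpha>: "0 \<le> \<alpha>" and i: "i \<in> {1..m}"
  shows "{x \<in> space (Pi\<^sub>M {1..m} (\<lambda>_. borel)). i \<in> BH_rule m \<sigma> \<alpha> x} \<in> sets (Pi\<^sub>M {1..m} (\<lambda>_. borel))"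
proof -
  have comp: "(\<lambda>x. x j) \<in> borel_measurable (Pi\<^sub>M {1..m} (\<lambda>_. borel))" if "j \<in> {1..m}" for j
    using that by (rule measurable_component_singleton)
  note pm = measurable_compose[OF comp p_value_measurable]
  have card: "k \<le> card {j \<in> {1..m}. Q j} \<longleftrightarrow> (\<exists>J\<in>{J. J \<subseteq> {1..m} \<and> k \<le> card J}. \<forall>j\<in>J. Q j)" for k Q
  proof
    assume "k \<le> card {j \<in> {1..m}. Q j}"
    thus "\<exists>J\<in>{J. J \<subseteq> {1..m} \<and> k \<le> card J}. \<forall>j\<in>J. Q j"
      by (intro bexI[of _ "{j \<in> {1..m}. Q j}"]) auto
  next
    assume "\<exists>J\<in>{J. J \<subseteq> {1..m} \<and> k \<le> card J}. \<forall>j\<in>J. Q j"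
    then obtain J where "J \<subseteq> {1..m}" "k \<le> card J" "\<forall>j\<in>J. Q j" by blast
    moreover from this have "J \<subseteq> {j \<in> {1..m}. Q j}" by blast
    ultimately show "k \<le> card {j \<in> {1..m}. Q j}"
      using card_mono[of "{j \<in> {1..m}. Q j}" J] by simp
  qed
  have p: "Measurable.pred (Pi\<^sub>M {1..m} (\<lambda>_. borel)) (\<lambda>x. p_value \<sigma> (x j) \<le> t)"
    if "j \<in> {1..m}" for j t using pm[OF that] by measurable
  have "Measurable.pred (Pi\<^sub>M {1..m} (\<lambda>_. borel)) (\<lambda>x. i \<in> BH_rule m \<sigma> \<alpha> x)"
    unfolding mem_BH_rule_iff[OF \<alpha>] card using i
    by (intro pred_intros_logic pred_intros_finite p) (auto intro: finite_subset)
  thus ?thesis by (simp add: pred_def)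
qed

section \<open>Type I errors\<close>

lemma power_self_le_fact_exp: "real w ^ w \<le> fact w * exp (real w)"
proof -
  have "(\<Sum>n\<in>{w}. inverse (fact n) *\<^sub>R real w ^ n) \<le> (\<Sum>n. inverse (fact n) *\<^sub>R real w ^ n)"
    by (intro sum_le_suminf summable_exp_generic) auto
  thus ?thesis by (simp add: exp_def field_simps)
qed

lemma binomial_power_le:
  assumes c: "0 \<le> c" and m: "0 < m"
  shows "real (m choose w) * (c * real w / real m) ^ w \<le> (c * exp 1) ^ w"
proof -
  have "real (m choose w) * fact w \<le> real m ^ w"
    using binomial_fact_pow[of m w] by (metis of_nat_fact of_nat_le_iff of_nat_mult of_nat_power)
  hence "real (m choose w) \<le> real m ^ w / fact w" by (simp add: field_simps)
  hence "real (m choose w) * (c * real w / real m) ^ w \<le> real m ^ w / fact w * (c * real w / real m) ^ w"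
    using c by (intro mult_right_mono) auto
  also have "\<dots> = c ^ w * (real w ^ w / fact w)"
    using m by (simp add: power_mult_distrib power_divide)
  also have "\<dots> \<le> c ^ w * exp (real w)"
    using c power_self_le_fact_exp[of w] by (intro mult_left_mono) (auto simp: field_simps)
  also have "\<dots> = (c * exp 1) ^ w"
    by (simp add: power_mult_distrib exp_of_nat_mult[symmetric])
  finally show ?thesis .
qed

lemma sum_index_power_le:
  fixes x :: real
  assumes x: "0 \<le> x" "x \<le> 1 / 2"
  shows "(\<Sum>w = 1..n. real w * x ^ w) \<le> 4 * x"
proof -
  have "(\<Sum>w = 1..n. real w * x ^ w) \<le> x * (4 - (2 * real n + 4) / 2 ^ n)"
  proof (induction n)
    case (Suc n)
    have "real (Suc n) * x ^ Suc n \<le> x * (real (Suc n) * (1 / 2) ^ n)"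
      using x power_mono[OF x(2,1), of n] by (simp add: mult_left_mono mult.left_commute)
    also have "\<dots> = x * ((2 * real n + 4) / 2 ^ n - (2 * real (Suc n) + 4) / 2 ^ Suc n)"
      by (simp add: field_simps)
    finally show ?case using Suc by (simp add: algebra_simps)
  qed simp
  also have "\<dots> \<le> x * 4" using x by (intro mult_left_mono) auto
  finally show ?thesis by simp
qed

text \<open>
  The pathwise bound on the number \<open>V\<close> of false rejections, with \<open>n i \<noteq> 0\<close> marking the
  signals: either \<open>V\<close> is at most \<open>\<epsilon>\<close> times the number of signals, or the
  summand with \<open>w = V\<close> equals \<open>V\<close>.
\<close>
lemma BH_false_rejections_le:
  fixes n :: "nat \<Rightarrow> nat" and x :: "nat \<Rightarrow> real" and m :: nat and \<sigma> :: real
  assumes \<alpha>: "0 < \<alpha>" and \<epsilon>: "0 < \<epsilon>"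
  defines "V \<equiv> card {i \<in> {1..m}. i \<in> BH_rule m \<sigma> \<alpha> x \<and> n i = 0}"
  shows "real V \<le> \<epsilon> * real (card {i \<in> {1..m}. n i \<noteq> 0}) +
    (\<Sum>w = 1..m. real w * of_bool (w \<le> card {j \<in> {1..m}. n j = 0 \<and>
       p_value \<sigma> (x j) \<le> \<alpha> * (1 + 1 / \<epsilon>) * real w / real m}))"
proof (cases "real V \<le> \<epsilon> * real (card {i \<in> {1..m}. n i \<noteq> 0})")
  case True
  thus ?thesis by (intro add_increasing2 sum_nonneg) auto
next
  case False
  define S where "S = card {i \<in> {1..m}. n i \<noteq> 0}"
  define F where "F w = real w * of_bool (w \<le> card {j \<in> {1..m}. n j = 0 \<and>
       p_value \<sigma> (x j) \<le> \<alpha> * (1 + 1 / \<epsilon>) * real w / real m})" for w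
  have less: "\<epsilon> * real S < real V" using False by (simp add: S_def)
  have "0 \<le> \<epsilon> * real S" using \<epsilon> by simp
  hence "V \<noteq> 0" using less by auto
  moreover have "V \<le> card {1..m}" unfolding V_def by (intro card_mono) auto
  ultimately have V: "V \<in> {1..m}" by simp
  have "card (BH_rule m \<sigma> \<alpha> x) \<le>
      card ({i \<in> {1..m}. i \<in> BH_rule m \<sigma> \<alpha> x \<and> n i = 0} \<union> {i \<in> {1..m}. n i \<noteq> 0})"
    using BH_rule_subset[of m \<sigma> \<alpha> x] by (intro card_mono) auto
  also have "\<dots> \<le> V + S" unfolding V_def S_def by (rule card_Un_le)
  finally have "real (card (BH_rule m \<sigma> \<alpha> x)) \<le> real V + real S" by linarith
  also have "\<dots> \<le> real V * (1 + 1 / \<epsilon>)" using less \<epsilon> by (simp add: field_simps)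
  finally have R: "real (card (BH_rule m \<sigma> \<alpha> x)) * \<alpha> / real m \<le> \<alpha> * (1 + 1 / \<epsilon>) * real V / real m"
    using \<alpha> by (intro divide_right_mono) (auto simp: mult_ac)
  have "{i \<in> {1..m}. i \<in> BH_rule m \<sigma> \<alpha> x \<and> n i = 0} \<subseteq> {j \<in> {1..m}. n j = 0 \<and>
       p_value \<sigma> (x j) \<le> \<alpha> * (1 + 1 / \<epsilon>) * real V / real m}"
    using order_trans[OF BH_rule_self_consistent[OF less_imp_le[OF \<alpha>]] R] by blast
  hence "V \<le> card {j \<in> {1..m}. n j = 0 \<and> p_value \<sigma> (x j) \<le> \<alpha> * (1 + 1 / \<epsilon>) * real V / real m}"
    unfolding V_def[symmetric] by (subst V_def, intro card_mono) auto
  hence "real V = F V" by (simp add: F_def)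
  also have "\<dots> \<le> (\<Sum>w = 1..m. F w)"
    using V by (intro member_le_sum) (auto simp: F_def)
  also have "\<dots> \<le> \<epsilon> * real S + (\<Sum>w = 1..m. F w)" using \<open>0 \<le> \<epsilon> * real S\<close> by simp
  finally show ?thesis by (simp add: F_def S_def)
qed

lemma rejected_BH_rule: "rejected m X (BH_rule m \<sigma> \<alpha>) \<omega> = BH_rule m \<sigma> \<alpha> (\<lambda>i. X i \<omega>)"
proof -
  have "map (\<lambda>j. p_value \<sigma> ((\<lambda>i\<in>{1..m}. X i \<omega>) j)) [1..<Suc m] =
      map (\<lambda>j. p_value \<sigma> (X j \<omega>)) [1..<Suc m]"
    by (intro map_cong) auto
  hence "ordered_p_value m \<sigma> (\<lambda>i\<in>{1..m}. X i \<omega>) = ordered_p_value m \<sigma> (\<lambda>i. X i \<omega>)"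
    unfolding ordered_p_value_def[abs_def] by (simp only:)
  thus ?thesis unfolding rejected_def BH_rule_def Let_def
    by (auto cong: conj_cong)
qed

context two_groups
begin

lemma sd_mix_pos: "0 < sqrt (\<sigma>\<^sup>2 + \<tau>\<^sup>2)"
  using sd_pos by (simp add: add_pos_pos)

lemma prob_all_null_p_values_le:
  assumes J: "J \<subseteq> {1..m}" "J \<noteq> {}" and t: "0 < t"
  shows "prob {\<omega> \<in> space M. \<forall>j\<in>J. \<nu> j \<omega> = 0 \<and> p_value \<sigma> (X j \<omega>) \<le> t} \<le> t ^ card J"
proof -
  let ?B = "{x. p_value \<sigma> x \<le> t}"
  have B: "?B \<in> sets borel" by measurable
  have finJ: "finite J" using J(1) by (rule finite_subset) simp
  have "{\<omega> \<in> space M. \<forall>j\<in>J. \<nu> j \<omega> = 0 \<and> p_value \<sigma> (X j \<omega>) \<le> t} =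
      (\<Inter>j\<in>J. (\<lambda>\<omega>. (\<nu> j \<omega>, X j \<omega>)) -` ({0} \<times> ?B) \<inter> space M)"
    using J(2) by auto
  also have "prob \<dots> = (\<Prod>j\<in>J. prob ((\<lambda>\<omega>. (\<nu> j \<omega>, X j \<omega>)) -` ({0} \<times> ?B) \<inter> space M))"
    using J finJ B by (intro indep_varsD[OF indep] pair_measureI) auto
  also have "\<dots> \<le> (\<Prod>j\<in>J. t)"
  proof (intro prod_mono conjI measure_nonneg)
    fix j assume j: "j \<in> J"
    have "prob ((\<lambda>\<omega>. (\<nu> j \<omega>, X j \<omega>)) -` ({0} \<times> ?B) \<inter> space M) =
        prob {\<omega> \<in> space M. X j \<omega> \<in> ?B \<and> \<nu> j \<omega> = 0}"
      by (rule arg_cong[where f = prob]) auto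
    also have "\<dots> = (1 - p) * measure (density lborel (normal_density 0 \<sigma>)) ?B"
      using j J B by (intro joint_prob(1)) auto
    also have "\<dots> \<le> 1 * t"
      using p_bounds null_p_value_le[OF sd_pos(1) t] by (intro mult_mono) auto
    finally show "prob ((\<lambda>\<omega>. (\<nu> j \<omega>, X j \<omega>)) -` ({0} \<times> ?B) \<inter> space M) \<le> t" by simp
  qed
  finally show ?thesis by simp
qed

text \<open>
  The probability bound is the union bound over all sets of \<open>w\<close> indices.
\<close>
lemma null_count_measurable:
  "{\<omega> \<in> space M. w \<le> card {j \<in> {1..m}. \<nu> j \<omega> = 0 \<and> p_value \<sigma> (X j \<omega>) \<le> t}} \<in> sets M"
    (is "?E \<in> _")
  and prob_null_count_le:
  "1 \<le> w \<Longrightarrow> 0 < t \<Longrightarrow> prob {\<omega> \<in> space M. w \<le> card {j \<in> {1..m}. \<nu> j \<omega> = 0 \<and> p_value \<sigma> (X j \<omega>) \<le> t}}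
    \<le> real (m choose w) * t ^ w"
proof -
  define A where "A J = {\<omega> \<in> space M. \<forall>j\<in>J. \<nu> j \<omega> = 0 \<and> p_value \<sigma> (X j \<omega>) \<le> t}" for J
  define W where "W = {J. J \<subseteq> {1..m} \<and> card J = w}"
  have finW: "finite W" by (rule finite_subset[of _ "Pow {1..m}"]) (auto simp: W_def)
  have A: "A J \<in> sets M" if "J \<in> W" for J
  proof -
    have "Measurable.pred M (\<lambda>\<omega>. \<nu> j \<omega> = 0 \<and> p_value \<sigma> (X j \<omega>) \<le> t)" if "j \<in> {1..m}" for j
      using nu_X_measurable[OF that] by measurable
    moreover have "finite J" using that by (auto simp: W_def intro: finite_subset)
    ultimately have "Measurable.pred M (\<lambda>\<omega>. \<forall>j\<in>J. \<nu> j \<omega> = 0 \<and> p_value \<sigma> (X j \<omega>) \<le> t)"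
      using that by (intro pred_intros_finite) (auto simp: W_def)
    thus ?thesis by (simp add: A_def pred_def)
  qed
  have eq: "?E = (\<Union>J\<in>W. A J)"
  proof (intro equalityI subsetI)
    fix \<omega> assume \<omega>: "\<omega> \<in> ?E"
    hence "w \<le> card {j \<in> {1..m}. \<nu> j \<omega> = 0 \<and> p_value \<sigma> (X j \<omega>) \<le> t}" by blast
    then obtain J where "J \<subseteq> {j \<in> {1..m}. \<nu> j \<omega> = 0 \<and> p_value \<sigma> (X j \<omega>) \<le> t}" "card J = w"
      by (rule obtain_subset_with_card_n)
    thus "\<omega> \<in> (\<Union>J\<in>W. A J)" using \<omega> unfolding W_def A_def by blast
  next
    fix \<omega> assume "\<omega> \<in> (\<Union>J\<in>W. A J)"
    then obtain J where J: "J \<in> W" "\<omega> \<in> A J" by auto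
    hence "card J \<le> card {j \<in> {1..m}. \<nu> j \<omega> = 0 \<and> p_value \<sigma> (X j \<omega>) \<le> t}"
      by (intro card_mono) (auto simp: W_def A_def)
    thus "\<omega> \<in> ?E" using J unfolding W_def A_def by blast
  qed
  show "?E \<in> sets M" unfolding eq using finW A by auto
  assume w: "1 \<le> w" and t: "0 < t"
  have "prob (\<Union>J\<in>W. A J) \<le> (\<Sum>J\<in>W. prob (A J))"
    using finW A by (intro finite_measure_subadditive_finite) auto
  also have "\<dots> \<le> (\<Sum>J\<in>W. t ^ w)"
  proof (rule sum_mono)
    fix J assume "J \<in> W"
    hence J: "J \<subseteq> {1..m}" "card J = w" by (auto simp: W_def)
    hence "J \<noteq> {}" using w by auto
    from prob_all_null_p_values_le[OF J(1) this t] show "prob (A J) \<le> t ^ w"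
      by (simp add: A_def J(2))
  qed
  also have "\<dots> = real (m choose w) * t ^ w"
    using n_subsets[of "{1..m}" w] by (simp add: W_def)
  finally show "prob ?E \<le> real (m choose w) * t ^ w" unfolding eq .
qed

lemma nonnull_prob:
  assumes "i \<in> {1..m}"
  shows "{\<omega> \<in> space M. \<nu> i \<omega> \<noteq> 0} \<in> sets M" "prob {\<omega> \<in> space M. \<nu> i \<omega> \<noteq> 0} = p"
proof -
  have [measurable]: "\<nu> i \<in> M \<rightarrow>\<^sub>M count_space UNIV" by (rule nu_X_measurable[OF assms])
  show "{\<omega> \<in> space M. \<nu> i \<omega> \<noteq> 0} \<in> sets M" by measurable
  have "{\<omega> \<in> space M. \<nu> i \<omega> = 0} \<in> sets M" by measurable
  from prob_neg[OF this] show "prob {\<omega> \<in> space M. \<nu> i \<omega> \<noteq> 0} = p"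
    using prob_null[OF assms] by simp
qed

lemma card_eq_sum_of_bool: "real (card {i \<in> {1..m}. P i}) = (\<Sum>i = 1..m. of_bool (P i))"
  by (simp add: of_bool_def Int_def flip: sum.inter_filter)

lemma expected_false_rejections_BH_le:
  assumes m: "1 \<le> m" and \<alpha>: "0 < \<alpha>" and \<epsilon>: "0 < \<epsilon>"
  defines "c \<equiv> \<alpha> * (1 + 1 / \<epsilon>)"
  assumes small: "c * exp 1 \<le> 1 / 2"
  shows "(\<integral>\<omega>. real (false_rejections m \<nu> X (BH_rule m \<sigma> \<alpha>) \<omega>) \<partial>M) \<le>
    \<epsilon> * (real m * p) + 4 * (c * exp 1)"
proof -
  have c: "0 < c" using \<alpha> \<epsilon> by (simp add: c_def add_pos_pos)
  define N where "N i = {\<omega> \<in> space M. \<nu> i \<omega> \<noteq> 0}" for i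
  define E where "E w = {\<omega> \<in> space M. w \<le> card {j \<in> {1..m}. \<nu> j \<omega> = 0 \<and>
       p_value \<sigma> (X j \<omega>) \<le> c * real w / real m}}" for w
  define g where "g \<omega> = \<epsilon> * (\<Sum>i = 1..m. indicator (N i) \<omega>) +
    (\<Sum>w = 1..m. real w * indicator (E w) \<omega>)" for \<omega>
  have N: "N i \<in> sets M" "prob (N i) = p" if "i \<in> {1..m}" for i
    using nonnull_prob[OF that] by (simp_all add: N_def)
  have E: "E w \<in> sets M" for w unfolding E_def by (rule null_count_measurable)
  have int: "integrable M (indicator (N i) :: _ \<Rightarrow> real)" if "i \<in> {1..m}" for i
    using N(1)[OF that] by (simp add: emeasure_eq_measure)
  have intE: "integrable M (indicator (E w) :: _ \<Rightarrow> real)" for w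
    using E[of w] by (simp add: emeasure_eq_measure)
  have "integrable M g" unfolding g_def using int intE
    by (intro Bochner_Integration.integrable_add integrable_mult_right Bochner_Integration.integrable_sum) auto
  moreover have "real (false_rejections m \<nu> X (BH_rule m \<sigma> \<alpha>) \<omega>) \<le> g \<omega>" if "\<omega> \<in> space M" for \<omega>
    using BH_false_rejections_le[OF \<alpha> \<epsilon>, of m \<sigma> "\<lambda>i. X i \<omega>" "\<lambda>i. \<nu> i \<omega>"] that
    unfolding false_rejections_def rejected_BH_rule g_def c_def[symmetric] card_eq_sum_of_bool[of "\<lambda>i. \<nu> i \<omega> \<noteq> 0"]
    by (simp add: N_def E_def indicator_def of_bool_def)
  ultimately have "(\<integral>\<omega>. real (false_rejections m \<nu> X (BH_rule m \<sigma> \<alpha>) \<omega>) \<partial>M) \<le> (\<integral>\<omega>. g \<omega> \<partial>M)"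
    by (rule integral_mono') (auto simp: g_def intro!: add_nonneg_nonneg sum_nonneg mult_nonneg_nonneg less_imp_le[OF \<epsilon>])
  also have "\<dots> = \<epsilon> * (\<Sum>i = 1..m. prob (N i)) + (\<Sum>w = 1..m. real w * prob (E w))"
  proof -
    have "(\<integral>\<omega>. (\<Sum>i = 1..m. indicator (N i) \<omega>) \<partial>M) = (\<Sum>i = 1..m. prob (N i))"
      using int N(1) by (subst Bochner_Integration.integral_sum) auto
    moreover have "(\<integral>\<omega>. (\<Sum>w = 1..m. real w * indicator (E w) \<omega>) \<partial>M) =
        (\<Sum>w = 1..m. real w * prob (E w))"
    proof (subst Bochner_Integration.integral_sum)
      show "(\<Sum>w = 1..m. \<integral>\<omega>. real w * indicator (E w) \<omega> \<partial>M) = (\<Sum>w = 1..m. real w * prob (E w))"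
        using E by (intro sum.cong) simp_all
    qed (intro integrable_mult_right intE)
    ultimately show ?thesis
      unfolding g_def using int intE
      by (subst Bochner_Integration.integral_add)
        (simp_all only: integrable_mult_right Bochner_Integration.integrable_sum integral_mult_right_zero)
  qed
  also have "(\<Sum>i = 1..m. prob (N i)) = real m * p" using N by simp
  also have "(\<Sum>w = 1..m. real w * prob (E w)) \<le> (\<Sum>w = 1..m. real w * (c * exp 1) ^ w)"
  proof (intro sum_mono mult_left_mono)
    fix w assume w: "w \<in> {1..m}"
    hence "prob (E w) \<le> real (m choose w) * (c * real w / real m) ^ w"
      unfolding E_def using c by (intro prob_null_count_le) auto
    also have "\<dots> \<le> (c * exp 1) ^ w" using c m by (intro binomial_power_le) auto
    finally show "prob (E w) \<le> (c * exp 1) ^ w" .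
  qed auto
  also have "\<dots> \<le> 4 * (c * exp 1)" using c small by (intro sum_index_power_le) auto
  finally show ?thesis by simp
qed

text \<open>
  The choice \<open>\<epsilon> = sqrt \<alpha>\<close>, for which \<open>\<alpha> (1 + 1/\<epsilon>) = \<alpha> + sqrt \<alpha>\<close>.
\<close>
lemma false_rejections_BH_le:
  assumes m: "1 \<le> m" and \<alpha>: "0 < \<alpha>" and small: "(\<alpha> + sqrt \<alpha>) * exp 1 \<le> 1 / 2"
  shows "(\<integral>\<omega>. real (false_rejections m \<nu> X (BH_rule m \<sigma> \<alpha>) \<omega>) \<partial>M) \<le>
    sqrt \<alpha> * (real m * p) + 4 * ((\<alpha> + sqrt \<alpha>) * exp 1)"
proof -
  have "\<alpha> / sqrt \<alpha> = sqrt \<alpha>" using \<alpha> by (simp add: real_div_sqrt)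
  hence "\<alpha> * (1 + 1 / sqrt \<alpha>) = \<alpha> + sqrt \<alpha>" by (simp add: distrib_left)
  thus ?thesis
    using expected_false_rejections_BH_le[OF m \<alpha>, of "sqrt \<alpha>"] \<alpha> small by simp
qed

end

section \<open>Type II errors\<close>

context two_groups
begin

text \<open>
  A signal with \<open>\<bar>X i\<bar> \<ge> \<sigma> z\<close> is called a hit below; \<open>y\<close> is the cutoff \<open>\<sigma> z\<close> in units of
  the standard deviation of \<open>X i\<close> under the alternative.
\<close>
lemma hit_prob:
  assumes i: "i \<in> {1..m}" and z: "0 \<le> z"
  defines "y \<equiv> \<sigma> * z / sqrt (\<sigma>\<^sup>2 + \<tau>\<^sup>2)"
  shows "prob {\<omega> \<in> space M. \<nu> i \<omega> = 1 \<and> \<bar>X i \<omega>\<bar> < \<sigma> * z} = p * central_mass y"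
    and "prob {\<omega> \<in> space M. \<nu> i \<omega> = 1 \<and> \<sigma> * z \<le> \<bar>X i \<omega>\<bar>} = p * (1 - central_mass y)"
proof -
  have y: "0 \<le> y" "\<sigma> * z = sqrt (\<sigma>\<^sup>2 + \<tau>\<^sup>2) * y"
    using z sd_pos sd_mix_pos by (auto simp: y_def)
  have "prob {\<omega> \<in> space M. X i \<omega> \<in> {x. \<bar>x\<bar> < \<sigma> * z} \<and> \<nu> i \<omega> = 1} = p * central_mass y"
    using measure_normal_central[OF sd_mix_pos y(1)] unfolding y(2)
    by (subst joint_prob(2)[OF i]) auto
  thus "prob {\<omega> \<in> space M. \<nu> i \<omega> = 1 \<and> \<bar>X i \<omega>\<bar> < \<sigma> * z} = p * central_mass y"
    by (simp add: conj_commute)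
  have "prob {\<omega> \<in> space M. X i \<omega> \<in> {x. \<sigma> * z \<le> \<bar>x\<bar>} \<and> \<nu> i \<omega> = 1} = p * (1 - central_mass y)"
    using measure_normal_tails[OF sd_mix_pos y(1)] unfolding y(2)
    by (subst joint_prob(2)[OF i]) auto
  thus "prob {\<omega> \<in> space M. \<nu> i \<omega> = 1 \<and> \<sigma> * z \<le> \<bar>X i \<omega>\<bar>} = p * (1 - central_mass y)"
    by (simp add: conj_commute)
qed

lemma few_other_hits_measurable:
  assumes i: "i \<in> {1..m}"
  shows "{\<omega> \<in> space M. \<nu> i \<omega> = 1 \<and>
    1 + real (card {j \<in> {1..m} - {i}. \<nu> j \<omega> = 1 \<and> \<sigma> * z \<le> \<bar>X j \<omega>\<bar>}) < a} \<in> sets M"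
proof -
  have card: "real (card {j \<in> {1..m} - {i}. \<nu> j \<omega> = 1 \<and> \<sigma> * z \<le> \<bar>X j \<omega>\<bar>}) =
      (\<Sum>j\<in>{1..m} - {i}. if \<nu> j \<omega> = 1 \<and> \<sigma> * z \<le> \<bar>X j \<omega>\<bar> then 1 else 0)" for \<omega>
    by (simp flip: sum.inter_filter)
  have "(\<lambda>\<omega>. if \<nu> j \<omega> = 1 \<and> \<sigma> * z \<le> \<bar>X j \<omega>\<bar> then 1 else 0 :: real) \<in> borel_measurable M"
    if "j \<in> {1..m}" for j
    using nu_X_measurable[OF that] by measurable
  hence [measurable]: "(\<lambda>\<omega>. \<Sum>j\<in>{1..m} - {i}. if \<nu> j \<omega> = 1 \<and> \<sigma> * z \<le> \<bar>X j \<omega>\<bar> then 1 else 0 :: real)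
      \<in> borel_measurable M"
    by (intro borel_measurable_sum) auto
  have [measurable]: "\<nu> i \<in> M \<rightarrow>\<^sub>M count_space UNIV" by (rule nu_X_measurable[OF i])
  show ?thesis unfolding card by measurable
qed

text \<open>
  A missed signal either is no hit, or is a hit while there are too few other hits for the procedure to
  reject at \<open>t\<close>. The number \<open>B\<close> bounds the probability of the latter, given that \<open>i\<close> is a signal; counting
  only hits other than \<open>i\<close> makes the count independent of \<open>\<nu> i\<close>.
\<close>
lemma expected_false_acceptances_BH_le:
  assumes \<alpha>: "0 < \<alpha>" and z: "0 \<le> z"
    and small: "\<And>x. \<sigma> * z \<le> \<bar>x\<bar> \<Longrightarrow> p_value \<sigma> x \<le> t"
    and B: "\<And>i. i \<in> {1..m} \<Longrightarrow> prob {\<omega> \<in> space M. \<nu> i \<omega> = 1 \<and>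
      1 + real (card {j \<in> {1..m} - {i}. \<nu> j \<omega> = 1 \<and> \<sigma> * z \<le> \<bar>X j \<omega>\<bar>}) < real m * t / \<alpha>} \<le> p * B"
  shows "(\<integral>\<omega>. real (false_acceptances m \<nu> X (BH_rule m \<sigma> \<alpha>) \<omega>) \<partial>M) \<le>
    real m * p * (central_mass (\<sigma> * z / sqrt (\<sigma>\<^sup>2 + \<tau>\<^sup>2)) + B)"
proof -
  define E where "E i = {\<omega> \<in> space M. \<nu> i \<omega> = 1 \<and> \<bar>X i \<omega>\<bar> < \<sigma> * z}" for i
  define F where "F i = {\<omega> \<in> space M. \<nu> i \<omega> = 1 \<and>
    1 + real (card {j \<in> {1..m} - {i}. \<nu> j \<omega> = 1 \<and> \<sigma> * z \<le> \<bar>X j \<omega>\<bar>}) < real m * t / \<alpha>}" for i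
  define g where "g \<omega> = (\<Sum>i = 1..m. indicator (E i) \<omega> + indicator (F i) \<omega> :: real)" for \<omega>
  have E: "E i \<in> sets M" if "i \<in> {1..m}" for i
    unfolding E_def using nu_X_measurable[OF that] by measurable
  have F: "F i \<in> sets M" if "i \<in> {1..m}" for i
    unfolding F_def by (rule few_other_hits_measurable[OF that])
  have intE: "integrable M (indicator (E i) :: _ \<Rightarrow> real)" if "i \<in> {1..m}" for i
    using E[OF that] by (simp add: emeasure_eq_measure)
  have intF: "integrable M (indicator (F i) :: _ \<Rightarrow> real)" if "i \<in> {1..m}" for i
    using F[OF that] by (simp add: emeasure_eq_measure)
  have missed: "\<omega> \<in> E i \<union> F i"
    if \<omega>: "\<omega> \<in> space M" and i: "i \<in> {1..m}" "\<nu> i \<omega> = 1"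
      and rej: "i \<notin> BH_rule m \<sigma> \<alpha> (\<lambda>i. X i \<omega>)" for i \<omega>
  proof (cases "\<sigma> * z \<le> \<bar>X i \<omega>\<bar>")
    case True
    let ?H = "{j \<in> {1..m} - {i}. \<nu> j \<omega> = 1 \<and> \<sigma> * z \<le> \<bar>X j \<omega>\<bar>}"
    have "card (insert i ?H) \<le> card {j \<in> {1..m}. p_value \<sigma> (X j \<omega>) \<le> t}"
      using True i small by (intro card_mono) auto
    hence "1 + real (card ?H) \<le> real (card {j \<in> {1..m}. p_value \<sigma> (X j \<omega>) \<le> t})"
      by simp
    moreover have "\<not> real m * t / \<alpha> \<le> real (card {j \<in> {1..m}. p_value \<sigma> (X j \<omega>) \<le> t})"
      using BH_rule_rejects_below[OF \<alpha> i(1), of \<sigma> "\<lambda>i. X i \<omega>" t] rej small[OF True] by blast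
    ultimately have "1 + real (card ?H) < real m * t / \<alpha>" by linarith
    thus ?thesis using \<omega> i by (simp add: F_def)
  qed (use \<omega> i in \<open>auto simp: E_def\<close>)
  have "real (false_acceptances m \<nu> X (BH_rule m \<sigma> \<alpha>) \<omega>) \<le> g \<omega>" if "\<omega> \<in> space M" for \<omega>
    unfolding false_acceptances_def rejected_BH_rule card_eq_sum_of_bool g_def
    using missed[OF that] by (intro sum_mono) (auto simp: indicator_def of_bool_def)
  moreover have "integrable M g"
    unfolding g_def using intE intF
    by (intro Bochner_Integration.integrable_sum Bochner_Integration.integrable_add)
  moreover have "0 \<le> g \<omega>" for \<omega> by (simp add: g_def sum_nonneg)
  ultimately have "(\<integral>\<omega>. real (false_acceptances m \<nu> X (BH_rule m \<sigma> \<alpha>) \<omega>) \<partial>M) \<le> (\<integral>\<omega>. g \<omega> \<partial>M)"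
    by (intro integral_mono')
  also have "\<dots> = (\<Sum>i = 1..m. prob (E i) + prob (F i))"
    unfolding g_def
  proof (subst Bochner_Integration.integral_sum)
    show "(\<Sum>i = 1..m. \<integral>\<omega>. indicator (E i) \<omega> + indicator (F i) \<omega> \<partial>M) =
        (\<Sum>i = 1..m. prob (E i) + prob (F i))"
      using intE intF E F by (intro sum.cong) simp_all
  qed (intro Bochner_Integration.integrable_add intE intF)
  also have "\<dots> \<le> (\<Sum>i = 1..m. p * central_mass (\<sigma> * z / sqrt (\<sigma>\<^sup>2 + \<tau>\<^sup>2)) + p * B)"
    using B hit_prob(1)[OF _ z] by (intro sum_mono add_mono) (simp_all add: E_def F_def)
  finally show ?thesis by (simp add: algebra_simps)
qed

text \<open>
  A Chernoff bound: the indicator of fewer than \<open>a\<close> other hits is at most \<open>2\<^sup>a\<close> times the product of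
  independent factors, one half for each hit. Including the indicator of \<open>\<nu> i = 1\<close> as the \<open>i\<close>-th factor handles the
  joint event.
\<close>
lemma prob_few_other_hits_le:
  assumes i: "i \<in> {1..m}" and z: "0 \<le> z"
  defines "q \<equiv> 1 - central_mass (\<sigma> * z / sqrt (\<sigma>\<^sup>2 + \<tau>\<^sup>2))"
  shows "prob {\<omega> \<in> space M. \<nu> i \<omega> = 1 \<and>
      1 + real (card {j \<in> {1..m} - {i}. \<nu> j \<omega> = 1 \<and> \<sigma> * z \<le> \<bar>X j \<omega>\<bar>}) < a} \<le>
    p * (2 powr a * (1 - p * q / 2) ^ (m - 1))"
proof -
  let ?H = "\<lambda>\<omega>. {j \<in> {1..m} - {i}. \<nu> j \<omega> = 1 \<and> \<sigma> * z \<le> \<bar>X j \<omega>\<bar>}"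
  let ?E = "{\<omega> \<in> space M. \<nu> i \<omega> = 1 \<and> 1 + real (card (?H \<omega>)) < a}"
  define f :: "nat \<Rightarrow> nat \<times> real \<Rightarrow> real" where
    "f j w = (if j = i then of_bool (fst w = 1)
      else if fst w = 1 \<and> \<sigma> * z \<le> \<bar>snd w\<bar> then 1 / 2 else 1)" for j w
  define Y where "Y j \<omega> = f j (\<nu> j \<omega>, X j \<omega>)" for j \<omega>
  have f: "f j \<in> borel_measurable (count_space UNIV \<Otimes>\<^sub>M borel)" for j
    unfolding f_def by measurable
  have ind: "indep_vars (\<lambda>_. borel) Y {1..m}"
    unfolding Y_def[abs_def] by (rule indep_vars_compose2[OF indep f])
  have Y: "Y j \<in> borel_measurable M" if "j \<in> {1..m}" for j
    using ind that unfolding indep_vars_def by blast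
  have Y_bounds: "0 \<le> Y j \<omega>" "Y j \<omega> \<le> 1" for j \<omega> by (auto simp: Y_def f_def)
  have intY: "integrable M (Y j)" if "j \<in> {1..m}" for j
    using Y[OF that] Y_bounds by (intro integrable_const_bound[of _ 1]) auto
  have prod_int: "integrable M (\<lambda>\<omega>. \<Prod>j = 1..m. Y j \<omega>)"
    using ind intY by (intro indep_vars_integrable) auto
  have Yi: "(\<integral>\<omega>. Y i \<omega> \<partial>M) = p"
  proof -
    have [measurable]: "\<nu> i \<in> M \<rightarrow>\<^sub>M count_space UNIV" by (rule nu_X_measurable[OF i])
    have "(\<integral>\<omega>. Y i \<omega> \<partial>M) = (\<integral>\<omega>. indicator {\<omega> \<in> space M. \<nu> i \<omega> = 1} \<omega> \<partial>M)"
      by (intro Bochner_Integration.integral_cong) (auto simp: Y_def f_def indicator_def)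
    also have "\<dots> = p"
      using prob_alternative[OF i] by (simp add: Int_absorb1)
    finally show ?thesis .
  qed
  have Yj: "(\<integral>\<omega>. Y j \<omega> \<partial>M) = 1 - p * q / 2" if j: "j \<in> {1..m}" "j \<noteq> i" for j
  proof -
    let ?A = "{\<omega> \<in> space M. \<nu> j \<omega> = 1 \<and> \<sigma> * z \<le> \<bar>X j \<omega>\<bar>}"
    have A: "?A \<in> sets M" using nu_X_measurable[OF j(1)] by measurable
    have "(\<integral>\<omega>. Y j \<omega> \<partial>M) = (\<integral>\<omega>. 1 - 1 / 2 * indicator ?A \<omega> \<partial>M)"
      using j by (intro Bochner_Integration.integral_cong) (auto simp: Y_def f_def indicator_def)
    also have "\<dots> = 1 - 1 / 2 * prob ?A"
      using A by (subst Bochner_Integration.integral_diff)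
        (auto simp: emeasure_eq_measure prob_space Int_absorb1)
    also have "prob ?A = p * q" unfolding q_def by (rule hit_prob(2)[OF j(1) z])
    finally show ?thesis by simp
  qed
  have prod: "(\<Prod>j = 1..m. Y j \<omega>) = of_bool (\<nu> i \<omega> = 1) * (1 / 2) ^ card (?H \<omega>)" for \<omega>
  proof -
    have "(\<Prod>j = 1..m. Y j \<omega>) = Y i \<omega> * (\<Prod>j\<in>{1..m} - {i}. Y j \<omega>)"
      using i by (intro prod.remove) auto
    also have "(\<Prod>j\<in>{1..m} - {i}. Y j \<omega>) =
        (\<Prod>j\<in>{1..m} - {i}. if \<nu> j \<omega> = 1 \<and> \<sigma> * z \<le> \<bar>X j \<omega>\<bar> then 1 / 2 else 1)"
      by (intro prod.cong) (auto simp: Y_def f_def)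
    also have "\<dots> = (1 / 2) ^ card (?H \<omega>)"
      by (simp flip: prod.inter_filter)
    finally show ?thesis by (simp add: Y_def f_def)
  qed
  have E: "?E \<in> sets M" by (rule few_other_hits_measurable[OF i])
  have le: "indicator ?E \<omega> \<le> 2 powr a * (\<Prod>j = 1..m. Y j \<omega>)" for \<omega>
  proof (cases "\<omega> \<in> ?E")
    case True
    have "(1::real) = 2 powr a * 2 powr (- a)" by (simp add: powr_minus)
    also have "\<dots> \<le> 2 powr a * 2 powr (- real (card (?H \<omega>)))"
      using True by (intro mult_left_mono) auto
    also have "2 powr (- real (card (?H \<omega>))) = (1 / 2 :: real) ^ card (?H \<omega>)"
      by (simp add: powr_minus powr_realpow power_divide inverse_eq_divide)
    finally show ?thesis using True unfolding prod by simp
  qed (simp add: prod_nonneg Y_bounds)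
  have "prob ?E = (\<integral>\<omega>. indicator ?E \<omega> \<partial>M)" using E by (simp add: Int_absorb1)
  also have "\<dots> \<le> (\<integral>\<omega>. 2 powr a * (\<Prod>j = 1..m. Y j \<omega>) \<partial>M)"
    using prod_int le by (intro integral_mono') (auto intro!: mult_nonneg_nonneg prod_nonneg Y_bounds)
  also have "\<dots> = 2 powr a * (\<Prod>j = 1..m. \<integral>\<omega>. Y j \<omega> \<partial>M)"
    using ind intY by (simp only: integral_mult_right_zero) (subst indep_vars_lebesgue_integral; auto)
  also have "(\<Prod>j = 1..m. \<integral>\<omega>. Y j \<omega> \<partial>M) = p * (1 - p * q / 2) ^ (m - 1)"
  proof -
    have "(\<Prod>j = 1..m. \<integral>\<omega>. Y j \<omega> \<partial>M) = p * (\<Prod>j\<in>{1..m} - {i}. \<integral>\<omega>. Y j \<omega> \<partial>M)"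
      using i by (subst prod.remove[of _ i]) (auto simp: Yi)
    also have "(\<Prod>j\<in>{1..m} - {i}. \<integral>\<omega>. Y j \<omega> \<partial>M) = (\<Prod>j\<in>{1..m} - {i}. 1 - p * q / 2)"
      by (intro prod.cong) (auto simp: Yj)
    finally show ?thesis using i by simp
  qed
  finally show ?thesis by (simp add: mult_ac)
qed

lemma sd_ratio: "\<sigma> * z / sqrt (\<sigma>\<^sup>2 + \<tau>\<^sup>2) = z / sqrt (1 + u_param \<sigma> \<tau>)"
proof -
  have "\<sigma>\<^sup>2 + \<tau>\<^sup>2 = \<sigma>\<^sup>2 * (1 + u_param \<sigma> \<tau>)" using sd_pos by (simp add: u_param_def field_simps)
  thus ?thesis using sd_pos by (simp add: real_sqrt_mult)
qed

text \<open>
  The cutoff \<open>t = \<alpha> \<kappa> p\<close>, useful when \<open>m p\<close> is large: \<open>\<kappa> m p\<close> hits suffice to reject at \<open>t\<close>, which is at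
  most an eighth of their expected number \<open>m p (1 - central_mass y)\<close>.
\<close>
lemma false_acceptances_BH_le_many:
  assumes m: "2 \<le> m" and \<alpha>: "0 < \<alpha>" "\<alpha> \<le> 1" and \<kappa>: "0 < \<kappa>" "\<kappa> \<le> 1"
  defines "y \<equiv> sqrt (2 * ln (2 / (\<alpha> * (\<kappa> * p)))) / sqrt (1 + u_param \<sigma> \<tau>)"
  assumes q: "8 * \<kappa> \<le> 1 - central_mass y"
  shows "(\<integral>\<omega>. real (false_acceptances m \<nu> X (BH_rule m \<sigma> \<alpha>) \<omega>) \<partial>M) \<le>
    real m * p * (central_mass y + exp (- (\<kappa> * (real m * p))))"
proof -
  define t where "t = \<alpha> * (\<kappa> * p)"
  define z where "z = sqrt (2 * ln (2 / t))"
  define q where "q = 1 - central_mass y"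
  have t0: "0 < t" using \<alpha> \<kappa> p_bounds by (simp add: t_def)
  have "\<alpha> * (\<kappa> * p) \<le> 1 * (1 * 1)" using \<alpha> \<kappa> p_bounds by (intro mult_mono) auto
  hence t: "0 < t" "t \<le> 2" using t0 by (auto simp: t_def)
  have z: "0 \<le> z" using t by (simp add: z_def)
  have y: "\<sigma> * z / sqrt (\<sigma>\<^sup>2 + \<tau>\<^sup>2) = y" unfolding sd_ratio by (simp add: y_def z_def t_def)
  have "0 < u_param \<sigma> \<tau>" using sd_pos by (simp add: u_param_def)
  hence y0: "0 \<le> y" using z by (simp add: y_def z_def t_def)
  have q1: "0 \<le> q" "q \<le> 1" "8 * \<kappa> \<le> q"
    using central_mass_nonneg[OF y0] central_mass_less_1[of y] q by (auto simp: q_def)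
  have a: "real m * t / \<alpha> = \<kappa> * (real m * p)" using \<alpha> by (simp add: t_def mult_ac)
  have pq: "p * q \<le> 1 * 1" using p_bounds q1 by (intro mult_mono) auto
  have "(1 - p * q / 2) ^ (m - 1) \<le> exp (- (p * q / 2)) ^ (m - 1)"
    using pq exp_ge_add_one_self[of "- (p * q / 2)"] by (intro power_mono) auto
  also have "\<dots> = exp (- (real (m - 1) * (p * q / 2)))"
    by (simp flip: exp_of_nat_mult)
  also have "\<dots> \<le> exp (- (2 * (\<kappa> * (real m * p))))"
  proof -
    have "2 * (\<kappa> * (real m * p)) = real m / 2 * (p * (8 * \<kappa>) / 2)" by simp
    also have "\<dots> \<le> real (m - 1) * (p * q / 2)"
      using m q1 p_bounds \<kappa> by (intro mult_mono divide_right_mono mult_left_mono) (auto simp: of_nat_diff)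
    finally show ?thesis by simp
  qed
  finally have pow: "(1 - p * q / 2) ^ (m - 1) \<le> exp (- (2 * (\<kappa> * (real m * p))))" .
  have mp: "0 \<le> \<kappa> * (real m * p)" using \<kappa> p_bounds by simp
  have two: "2 powr (\<kappa> * (real m * p)) \<le> exp (\<kappa> * (real m * p))"
    using mp ln_le_minus_one[of "2::real"] by (simp add: powr_def mult_left_le)
  have B: "2 powr (\<kappa> * (real m * p)) * (1 - p * q / 2) ^ (m - 1) \<le> exp (- (\<kappa> * (real m * p)))"
  proof -
    have "2 powr (\<kappa> * (real m * p)) * (1 - p * q / 2) ^ (m - 1) \<le>
        exp (\<kappa> * (real m * p)) * exp (- (2 * (\<kappa> * (real m * p))))"
      using two pow pq by (intro mult_mono) auto
    also have "\<dots> = exp (- (\<kappa> * (real m * p)))" by (simp flip: exp_add)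
    finally show ?thesis .
  qed
  show ?thesis
    unfolding y[symmetric]
  proof (rule expected_false_acceptances_BH_le[OF \<alpha>(1) z])
    show "p_value \<sigma> x \<le> t" if "\<sigma> * z \<le> \<bar>x\<bar>" for x
      using p_value_le_of_large[OF sd_pos(1) t] that by (simp add: z_def)
    fix i assume i: "i \<in> {1..m}"
    show "prob {\<omega> \<in> space M. \<nu> i \<omega> = 1 \<and>
        1 + real (card {j \<in> {1..m} - {i}. \<nu> j \<omega> = 1 \<and> \<sigma> * z \<le> \<bar>X j \<omega>\<bar>}) < real m * t / \<alpha>} \<le>
      p * exp (- (\<kappa> * (real m * p)))"
      using prob_few_other_hits_le[OF i z, of "real m * t / \<alpha>"] mult_left_mono[OF B, of p] p_bounds
      unfolding y q_def[symmetric] a by linarith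
  qed
qed

text \<open>
  The Bonferroni cutoff \<open>t = \<alpha> / m\<close>: even a single \<open>p\<close>-value up to it is rejected.
\<close>
lemma false_acceptances_BH_le_single:
  assumes m: "1 \<le> m" and \<alpha>: "0 < \<alpha>" "\<alpha> \<le> 1"
  shows "(\<integral>\<omega>. real (false_acceptances m \<nu> X (BH_rule m \<sigma> \<alpha>) \<omega>) \<partial>M) \<le>
    real m * p * central_mass (sqrt (2 * ln (2 / (\<alpha> * (1 / real m)))) / sqrt (1 + u_param \<sigma> \<tau>))"
proof -
  define t where "t = \<alpha> * (1 / real m)"
  define z where "z = sqrt (2 * ln (2 / t))"
  have "\<alpha> * (1 / real m) \<le> 1 * 1" using \<alpha> m by (intro mult_mono) auto
  moreover have "0 < t" using \<alpha> m by (simp add: t_def)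
  ultimately have t: "0 < t" "t \<le> 2" unfolding t_def by linarith+
  have z: "0 \<le> z" using t by (simp add: z_def)
  have a: "real m * t / \<alpha> = 1" using \<alpha> m by (simp add: t_def)
  have "(\<integral>\<omega>. real (false_acceptances m \<nu> X (BH_rule m \<sigma> \<alpha>) \<omega>) \<partial>M) \<le>
    real m * p * (central_mass (\<sigma> * z / sqrt (\<sigma>\<^sup>2 + \<tau>\<^sup>2)) + 0)"
  proof (rule expected_false_acceptances_BH_le[OF \<alpha>(1) z])
    show "p_value \<sigma> x \<le> t" if "\<sigma> * z \<le> \<bar>x\<bar>" for x
      using p_value_le_of_large[OF sd_pos(1) t] that by (simp add: z_def)
  qed (simp add: a)
  thus ?thesis unfolding sd_ratio by (simp add: z_def t_def)
qed

text \<open>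
  Only the type II errors of the oracle are counted. The bound is its exact expected number of false
  acceptances, times \<open>\<delta>\<^sub>A\<close>; \<open>v \<ge> 1\<close> ensures that the squared cutoff is nonnegative.
\<close>
lemma bayes_risk_oracle_ge:
  assumes \<delta>: "0 < \<delta>\<^sub>0" "0 < \<delta>\<^sub>A" and v: "1 \<le> v_param p \<sigma> \<tau> \<delta>\<^sub>0 \<delta>\<^sub>A"
  defines "u \<equiv> u_param \<sigma> \<tau>"
  shows "\<delta>\<^sub>A * (real m * p * central_mass (sqrt ((ln (v_param p \<sigma> \<tau> \<delta>\<^sub>0 \<delta>\<^sub>A) + ln (1 + 1 / u)) / u)))
    \<le> bayes_risk M m \<nu> X \<delta>\<^sub>0 \<delta>\<^sub>A (bayes_oracle m p \<sigma> \<tau> \<delta>\<^sub>0 \<delta>\<^sub>A)"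
proof -
  define T where "T = (1 + 1 / u) * (ln (v_param p \<sigma> \<tau> \<delta>\<^sub>0 \<delta>\<^sub>A) + ln (1 + 1 / u))"
  let ?o = "bayes_oracle m p \<sigma> \<tau> \<delta>\<^sub>0 \<delta>\<^sub>A"
  have u: "0 < u" using sd_pos by (simp add: u_def u_param_def)
  have T: "0 \<le> T" unfolding T_def using u v by (intro mult_nonneg_nonneg add_nonneg_nonneg) auto
  have iff: "i \<in> rejected m X ?o \<omega> \<longleftrightarrow> \<sigma> * sqrt T \<le> \<bar>X i \<omega>\<bar>" if "i \<in> {1..m}" for i \<omega>
  proof -
    have "i \<in> rejected m X ?o \<omega> \<longleftrightarrow> T \<le> (X i \<omega>)\<^sup>2 / \<sigma>\<^sup>2"
      using that by (auto simp: rejected_def bayes_oracle_def T_def u_def)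
    also have "(X i \<omega>)\<^sup>2 / \<sigma>\<^sup>2 = (\<bar>X i \<omega>\<bar> / \<sigma>)\<^sup>2" by (simp add: power_divide)
    also have "T \<le> (\<bar>X i \<omega>\<bar> / \<sigma>)\<^sup>2 \<longleftrightarrow> sqrt T \<le> \<bar>X i \<omega>\<bar> / \<sigma>"
      using sd_pos by (subst real_sqrt_le_iff[symmetric]) simp
    finally show ?thesis using sd_pos by (simp add: field_simps)
  qed
  define E where "E i = {\<omega> \<in> space M. \<nu> i \<omega> = 1 \<and> \<bar>X i \<omega>\<bar> < \<sigma> * sqrt T}" for i
  have E: "E i \<in> sets M" if "i \<in> {1..m}" for i
    unfolding E_def using nu_X_measurable[OF that] by measurable
  have "\<sigma> * sqrt T / sqrt (\<sigma>\<^sup>2 + \<tau>\<^sup>2) = sqrt (\<sigma>\<^sup>2 * T / (\<sigma>\<^sup>2 + \<tau>\<^sup>2))"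
    using sd_pos by (simp add: real_sqrt_divide real_sqrt_mult)
  also have "\<sigma>\<^sup>2 * T / (\<sigma>\<^sup>2 + \<tau>\<^sup>2) = T / (1 + u)"
    using sd_pos by (simp add: u_def u_param_def field_simps)
  also have "T / (1 + u) = (ln (v_param p \<sigma> \<tau> \<delta>\<^sub>0 \<delta>\<^sub>A) + ln (1 + 1 / u)) / u"
  proof -
    have "1 + 1 / u = (1 + u) / u" using u by (simp add: add_divide_distrib)
    thus ?thesis using u by (simp add: T_def)
  qed
  finally have PE: "prob (E i) = p * central_mass (sqrt ((ln (v_param p \<sigma> \<tau> \<delta>\<^sub>0 \<delta>\<^sub>A) + ln (1 + 1 / u)) / u))"
    if "i \<in> {1..m}" for i
    using hit_prob(1)[OF that, of "sqrt T"] T by (simp add: E_def)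
  have "(\<integral>\<omega>. real (false_acceptances m \<nu> X ?o \<omega>) \<partial>M) =
      (\<integral>\<omega>. (\<Sum>i = 1..m. indicator (E i) \<omega>) \<partial>M)"
  proof (rule Bochner_Integration.integral_cong[OF refl])
    fix \<omega> assume "\<omega> \<in> space M"
    thus "real (false_acceptances m \<nu> X ?o \<omega>) = (\<Sum>i = 1..m. indicator (E i) \<omega>)"
      unfolding false_acceptances_def card_eq_sum_of_bool
      by (intro sum.cong) (auto simp: iff E_def indicator_def of_bool_def)
  qed
  also have "\<dots> = (\<Sum>i = 1..m. prob (E i))"
  proof (subst Bochner_Integration.integral_sum)
    show "integrable M (indicator (E i) :: _ \<Rightarrow> real)" if "i \<in> {1..m}" for i
      using E[OF that] by (simp add: emeasure_eq_measure)
    show "(\<Sum>i = 1..m. \<integral>\<omega>. indicator (E i) \<omega> \<partial>M) = (\<Sum>i = 1..m. prob (E i))"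
      using E by (intro sum.cong) (simp_all add: Int_absorb1)
  qed
  finally have *: "(\<integral>\<omega>. real (false_acceptances m \<nu> X ?o \<omega>) \<partial>M) =
      real m * p * central_mass (sqrt ((ln (v_param p \<sigma> \<tau> \<delta>\<^sub>0 \<delta>\<^sub>A) + ln (1 + 1 / u)) / u))"
    by (simp add: PE)
  have "0 \<le> \<delta>\<^sub>0 * (\<integral>\<omega>. real (false_rejections m \<nu> X ?o \<omega>) \<partial>M)"
    using \<delta> by (intro mult_nonneg_nonneg Bochner_Integration.integral_nonneg) auto
  thus ?thesis unfolding bayes_risk_def * by linarith
qed

end

section \<open>Limits\<close>

text \<open>
  On the scale \<open>u\<close>, the terms \<open>log u\<close>, \<open>2 log (1 - p)\<close> and \<open>2 log \<delta>\<close> of \<open>log v\<close> vanish, which leaves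
  \<open>- 2 log p\<close>.
\<close>
lemma signal_strength_limit:
  fixes p \<sigma> \<tau> \<delta>\<^sub>0 \<delta>\<^sub>A :: "nat \<Rightarrow> real"
  defines "u \<equiv> \<lambda>m. u_param (\<sigma> m) (\<tau> m)"
  defines "v \<equiv> \<lambda>m. v_param (p m) (\<sigma> m) (\<tau> m) (\<delta>\<^sub>0 m) (\<delta>\<^sub>A m)"
  assumes p: "p \<longlonglongrightarrow> 0" "eventually (\<lambda>m. 0 < p m) sequentially"
    and u: "filterlim u at_top sequentially"
    and v: "(\<lambda>m. ln (v m) / u m) \<longlonglongrightarrow> C"
    and \<delta>: "0 < \<delta>" "eventually (\<lambda>m. \<delta>\<^sub>0 m / \<delta>\<^sub>A m = \<delta>) sequentially"
  shows "(\<lambda>m. - ln (p m) / u m) \<longlonglongrightarrow> C / 2"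
proof -
  have p1: "eventually (\<lambda>m. p m < 1) sequentially" using p(1) by (rule order_tendstoD) simp
  have u1: "eventually (\<lambda>m. 0 < u m) sequentially" using u by (simp add: filterlim_at_top_dense)
  have inf: "filterlim u at_infinity sequentially"
    using u by (rule filterlim_at_top_imp_at_infinity)
  have "(\<lambda>m. ln (1 - p m)) \<longlonglongrightarrow> ln (1 - 0)" using p(1) by (intro tendsto_intros) auto
  hence l: "(\<lambda>m. ln (1 - p m) / u m) \<longlonglongrightarrow> 0"
    by (rule tendsto_divide_0[OF _ inf])
  have d: "(\<lambda>m. ln \<delta> / u m) \<longlonglongrightarrow> 0" by (rule tendsto_divide_0[OF tendsto_const inf])
  have "(\<lambda>m. (ln (v m) / u m - ln (u m) / u m - 2 * (ln (1 - p m) / u m) - 2 * (ln \<delta> / u m)) / 2)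
      \<longlonglongrightarrow> (C - 0 - 2 * 0 - 2 * 0) / 2"
    by (intro tendsto_intros v filterlim_compose[OF ln_x_over_x_tendsto_0 u] l d) auto
  moreover have "eventually (\<lambda>m. (ln (v m) / u m - ln (u m) / u m - 2 * (ln (1 - p m) / u m) - 2 * (ln \<delta> / u m)) / 2
      = - ln (p m) / u m) sequentially"
    using p(2) p1 u1 \<delta>(2)
  proof eventually_elim
    case (elim m)
    have "ln (v m) = ln (u m) + ln (((1 - p m) / p m)\<^sup>2) + ln (\<delta>\<^sup>2)"
      using elim \<delta>(1) by (simp add: v_def v_param_def u_def f_param_def ln_mult_pos)
    also have "\<dots> = ln (u m) + 2 * (ln (1 - p m) - ln (p m)) + 2 * ln \<delta>"
      using elim \<delta>(1) by (simp add: ln_realpow ln_divide_pos)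
    finally have "- ln (p m) = (ln (v m) - ln (u m) - 2 * ln (1 - p m) - 2 * ln \<delta>) / 2" by simp
    thus ?case by (simp add: diff_divide_distrib)
  qed
  ultimately have "(\<lambda>m. - ln (p m) / u m) \<longlonglongrightarrow> (C - 0 - 2 * 0 - 2 * 0) / 2"
    by (rule Lim_transform_eventually)
  thus ?thesis by simp
qed

text \<open>
  The limit of the rejection cutoff at level \<open>t = \<alpha> s\<close>, in units of the standard deviation
  under the alternative.
\<close>
lemma critical_value_limit:
  fixes u s \<alpha> :: "nat \<Rightarrow> real"
  assumes u: "filterlim u at_top sequentially"
    and s: "(\<lambda>m. - ln (s m) / u m) \<longlonglongrightarrow> C / 2" "eventually (\<lambda>m. 0 < s m) sequentially"
    and \<alpha>: "(\<lambda>m. ln (\<alpha> m) / u m) \<longlonglongrightarrow> 0" "eventually (\<lambda>m. 0 < \<alpha> m) sequentially"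
  shows "(\<lambda>m. sqrt (2 * ln (2 / (\<alpha> m * s m))) / sqrt (1 + u m)) \<longlonglongrightarrow> sqrt C"
proof -
  have inf: "filterlim u at_infinity sequentially"
    using u by (rule filterlim_at_top_imp_at_infinity)
  have u1: "eventually (\<lambda>m. 0 < u m) sequentially" using u by (simp add: filterlim_at_top_dense)
  have c: "(\<lambda>m. c / u m) \<longlonglongrightarrow> 0" for c by (rule tendsto_divide_0[OF tendsto_const inf])
  have "(\<lambda>m. 2 * (ln 2 / u m - ln (\<alpha> m) / u m + - ln (s m) / u m) / (1 / u m + 1))
      \<longlonglongrightarrow> 2 * (0 - 0 + C / 2) / (0 + 1)"
    by (intro tendsto_intros c s \<alpha>) auto
  hence "(\<lambda>m. sqrt (2 * (ln 2 / u m - ln (\<alpha> m) / u m + - ln (s m) / u m) / (1 / u m + 1))) \<longlonglongrightarrow> sqrt C"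
    using tendsto_real_sqrt by fastforce
  moreover have "eventually (\<lambda>m. sqrt (2 * (ln 2 / u m - ln (\<alpha> m) / u m + - ln (s m) / u m) / (1 / u m + 1)) =
      sqrt (2 * ln (2 / (\<alpha> m * s m))) / sqrt (1 + u m)) sequentially"
    using u1 s(2) \<alpha>(2)
  proof eventually_elim
    case (elim m)
    have "ln (2 / (\<alpha> m * s m)) = ln 2 - ln (\<alpha> m) + - ln (s m)"
      using elim by (simp add: ln_divide_pos ln_mult_pos)
    moreover have "2 * (a / u m - b / u m + c / u m) / (1 / u m + 1) = 2 * (a - b + c) / (1 + u m)" for a b c
    proof -
      have "1 / u m + 1 = (1 + u m) / u m" using elim by (simp add: add_divide_distrib)
      moreover have "2 * (a / u m - b / u m + c / u m) = 2 * (a - b + c) / u m"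
        by (simp add: add_divide_distrib diff_divide_distrib)
      ultimately show ?thesis using elim by simp
    qed
    ultimately show ?case by (simp only: real_sqrt_divide)
  qed
  ultimately show ?thesis by (simp add: tendsto_cong)
qed

lemma propto_power_limits:
  fixes p u :: "nat \<Rightarrow> real"
  assumes c: "0 < c" and pm: "(\<lambda>m. p m / real m powr (- \<beta>)) \<longlonglongrightarrow> c"
    and p: "eventually (\<lambda>m. 0 < p m) sequentially"
  shows "\<beta> \<le> 1 \<Longrightarrow> eventually (\<lambda>m. c / 2 \<le> real m * p m) sequentially"
    and "\<beta> < 1 \<Longrightarrow> filterlim (\<lambda>m. real m * p m) at_top sequentially"
    and "filterlim u at_top sequentially \<Longrightarrow> (\<lambda>m. - ln (p m) / u m) \<longlonglongrightarrow> D \<Longrightarrow>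
      0 < \<beta> \<Longrightarrow> (\<lambda>m. ln (real m) / u m) \<longlonglongrightarrow> D / \<beta>"
proof -
  define r where "r m = p m / real m powr (- \<beta>)" for m
  have r: "r \<longlonglongrightarrow> c" using pm by (simp add: r_def[abs_def])
  have r2: "eventually (\<lambda>m. c / 2 < r m) sequentially" using r by (rule order_tendstoD) (use c in auto)
  have mp: "eventually (\<lambda>m. real m * p m = r m * real m powr (1 - \<beta>)) sequentially"
    using eventually_gt_at_top[of 0]
    by eventually_elim (simp add: r_def powr_minus powr_diff field_simps)
  show "eventually (\<lambda>m. c / 2 \<le> real m * p m) sequentially" if "\<beta> \<le> 1"
    using mp r2 eventually_ge_at_top[of 1]
  proof eventually_elim
    case (elim m)
    have "1 \<le> real m powr (1 - \<beta>)" using elim that by (intro ge_one_powr_ge_zero) auto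
    hence "c / 2 * 1 \<le> r m * real m powr (1 - \<beta>)" using elim c by (intro mult_mono) auto
    thus ?case using elim by simp
  qed
  show "filterlim (\<lambda>m. real m * p m) at_top sequentially" if "\<beta> < 1"
  proof -
    have "filterlim (\<lambda>m. real m powr (1 - \<beta>)) at_top sequentially"
      using that by real_asymp
    hence "filterlim (\<lambda>m. r m * real m powr (1 - \<beta>)) at_top sequentially"
      by (rule filterlim_tendsto_pos_mult_at_top[OF r c])
    thus ?thesis using mp by (simp add: filterlim_cong)
  qed
  show "(\<lambda>m. ln (real m) / u m) \<longlonglongrightarrow> D / \<beta>"
    if u: "filterlim u at_top sequentially" and D: "(\<lambda>m. - ln (p m) / u m) \<longlonglongrightarrow> D" and \<beta>: "0 < \<beta>"
  proof -
    have inf: "filterlim u at_infinity sequentially"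
      using u by (rule filterlim_at_top_imp_at_infinity)
    have "(\<lambda>m. ln (r m)) \<longlonglongrightarrow> ln c" using r c by (intro tendsto_intros) auto
    hence "(\<lambda>m. ln (r m) / u m) \<longlonglongrightarrow> 0" by (rule tendsto_divide_0[OF _ inf])
    hence "(\<lambda>m. (ln (r m) / u m + - ln (p m) / u m) / \<beta>) \<longlonglongrightarrow> (0 + D) / \<beta>"
      using \<beta> by (intro tendsto_intros D) auto
    moreover have "eventually (\<lambda>m. (ln (r m) / u m + - ln (p m) / u m) / \<beta> = ln (real m) / u m) sequentially"
      using p eventually_gt_at_top[of 0]
    proof eventually_elim
      case (elim m)
      have "ln (r m) = ln (p m) + \<beta> * ln (real m)"
        using elim by (simp add: r_def ln_divide_pos ln_powr)
      thus ?case using \<beta> by (simp add: add_divide_distrib)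
    qed
    ultimately show ?thesis by (simp add: tendsto_cong)
  qed
qed

theorem corollary5p1:
  fixes M :: "nat \<Rightarrow> 'a measure"
    and \<nu> :: "nat \<Rightarrow> nat \<Rightarrow> 'a \<Rightarrow> nat" and X :: "nat \<Rightarrow> nat \<Rightarrow> 'a \<Rightarrow> real"
    and p \<sigma> \<tau> \<delta>\<^sub>0 \<delta>\<^sub>A \<alpha> :: "nat \<Rightarrow> real" and C \<beta> \<delta> :: real
  assumes model: "\<And>m. m \<ge> 1 \<Longrightarrow> two_groups (M m) m (p m) (\<sigma> m) (\<tau> m) (\<nu> m) (X m)"
    and losses: "\<And>m. m \<ge> 1 \<Longrightarrow> \<delta>\<^sub>0 m > 0" "\<And>m. m \<ge> 1 \<Longrightarrow> \<delta>\<^sub>A m > 0"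
    and "p \<longlonglongrightarrow> 0"
    and "filterlim (\<lambda>m. u_param (\<sigma> m) (\<tau> m)) at_top sequentially"
    and "filterlim (\<lambda>m. v_param (p m) (\<sigma> m) (\<tau> m) (\<delta>\<^sub>0 m) (\<delta>\<^sub>A m)) at_top sequentially"
    and "C > 0"
    and "(\<lambda>m. ln (v_param (p m) (\<sigma> m) (\<tau> m) (\<delta>\<^sub>0 m) (\<delta>\<^sub>A m)) / u_param (\<sigma> m) (\<tau> m)) \<longlonglongrightarrow> C"
    and "0 < \<beta>" "\<beta> \<le> 1"
    and "seq_propto p (\<lambda>m. real m powr (- \<beta>))"
    and "\<And>m. m \<ge> 1 \<Longrightarrow> \<delta>\<^sub>0 m / \<delta>\<^sub>A m = \<delta>"
    and "\<And>m. m \<ge> 1 \<Longrightarrow> 0 < \<alpha> m \<and> \<alpha> m < 1"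
    and "\<alpha> \<longlonglongrightarrow> 0"
    and "(\<lambda>m. ln (\<alpha> m)) \<in> o(\<lambda>m. ln (real m))"
  shows "ABOS
    (\<lambda>m. bayes_risk (M m) m (\<nu> m) (X m) (\<delta>\<^sub>0 m) (\<delta>\<^sub>A m) (BH_rule m (\<sigma> m) (\<alpha> m)))
    (\<lambda>m. bayes_risk (M m) m (\<nu> m) (X m) (\<delta>\<^sub>0 m) (\<delta>\<^sub>A m)
       (bayes_oracle m (p m) (\<sigma> m) (\<tau> m) (\<delta>\<^sub>0 m) (\<delta>\<^sub>A m)))"
proof -
  note p_lim = assms(4) and u_lim = assms(5) and v_lim = assms(6) and C = assms(7)
    and C_lim = assms(8) and \<beta> = assms(9,10) and propto = assms(11) and \<delta>_eq = assms(12)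
    and \<alpha>_bounds = assms(13) and \<alpha>_lim = assms(14) and \<alpha>_log = assms(15)
  define u where "u m = u_param (\<sigma> m) (\<tau> m)" for m
  define v where "v m = v_param (p m) (\<sigma> m) (\<tau> m) (\<delta>\<^sub>0 m) (\<delta>\<^sub>A m)" for m
  define R where "R m = bayes_risk (M m) m (\<nu> m) (X m) (\<delta>\<^sub>0 m) (\<delta>\<^sub>A m) (BH_rule m (\<sigma> m) (\<alpha> m))" for m
  define Ropt where "Ropt m = bayes_risk (M m) m (\<nu> m) (X m) (\<delta>\<^sub>0 m) (\<delta>\<^sub>A m)
       (bayes_oracle m (p m) (\<sigma> m) (\<tau> m) (\<delta>\<^sub>0 m) (\<delta>\<^sub>A m))" for m
  define a where "a = central_mass (sqrt C)"
  have a: "0 < a" "a < 1"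
    using C central_mass_pos[of "sqrt C"] central_mass_less_1 by (auto simp: a_def)
  obtain c where c: "0 < c" "(\<lambda>m. p m / real m powr (- \<beta>)) \<longlonglongrightarrow> c"
    using propto by (auto simp: seq_propto_def)
  have \<delta>: "0 < \<delta>" using losses[of 1] \<delta>_eq[of 1] by (metis divide_pos_pos le_refl)
  have u_top: "filterlim u at_top sequentially" using u_lim by (simp add: u_def[abs_def])
  have v_top: "filterlim v at_top sequentially" using v_lim by (simp add: v_def[abs_def])
  have vu: "(\<lambda>m. ln (v m) / u m) \<longlonglongrightarrow> C" using C_lim by (simp add: u_def v_def)
  have u_inf: "filterlim u at_infinity sequentially"
    using u_top by (rule filterlim_at_top_imp_at_infinity)
  have p_pos: "0 < p m" "p m < 1" if "m \<ge> 1" for m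
    using two_groups.p_bounds[OF model[OF that]] by auto
  have ev1: "eventually (\<lambda>m. m \<ge> 1) sequentially" by (rule eventually_ge_at_top)
  have ev_p: "eventually (\<lambda>m. 0 < p m) sequentially" using ev1 by eventually_elim (rule p_pos)
  have ev_\<alpha>: "eventually (\<lambda>m. 0 < \<alpha> m) sequentially"
    using ev1 by eventually_elim (use \<alpha>_bounds in auto)
  have ln_p: "(\<lambda>m. - ln (p m) / u m) \<longlonglongrightarrow> C / 2"
    unfolding u_def
  proof (rule signal_strength_limit[OF p_lim ev_p u_lim C_lim \<delta>])
    show "eventually (\<lambda>m. \<delta>\<^sub>0 m / \<delta>\<^sub>A m = \<delta>) sequentially"
      using ev1 by eventually_elim (rule \<delta>_eq)
  qed
  have ln_m: "(\<lambda>m. ln (real m) / u m) \<longlonglongrightarrow> C / 2 / \<beta>"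
    by (rule propto_power_limits(3)[OF c ev_p u_top ln_p \<beta>(1)])
  have ln_\<alpha>: "(\<lambda>m. ln (\<alpha> m) / u m) \<longlonglongrightarrow> 0"
  proof -
    have "(\<lambda>m. ln (\<alpha> m) / ln (real m) * (ln (real m) / u m)) \<longlonglongrightarrow> 0 * (C / 2 / \<beta>)"
      by (intro tendsto_mult smalloD_tendsto \<alpha>_log ln_m)
    hence "(\<lambda>m. ln (\<alpha> m) / ln (real m) * (ln (real m) / u m)) \<longlonglongrightarrow> 0" by simp
    moreover have "eventually (\<lambda>m. ln (\<alpha> m) / ln (real m) * (ln (real m) / u m) = ln (\<alpha> m) / u m) sequentially"
      using eventually_gt_at_top[of 1] by eventually_elim simp
    ultimately show ?thesis by (rule Lim_transform_eventually)
  qed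
  have mp: "eventually (\<lambda>m. c / 2 \<le> real m * p m) sequentially"
    by (rule propto_power_limits(1)[OF c ev_p \<beta>(2)])

  define T2 where "T2 m = (\<integral>\<omega>. real (false_acceptances m (\<nu> m) (X m) (BH_rule m (\<sigma> m) (\<alpha> m)) \<omega>) \<partial>M m)" for m
  define T1 where "T1 m = (\<integral>\<omega>. real (false_rejections m (\<nu> m) (X m) (BH_rule m (\<sigma> m) (\<alpha> m)) \<omega>) \<partial>M m)" for m
  \<comment> \<open>\<open>h m\<close> bounds the probability that a given signal is missed.\<close>
  obtain h where h: "h \<longlonglongrightarrow> a" "eventually (\<lambda>m. T2 m \<le> real m * p m * h m) sequentially"
  proof (cases "\<beta> = 1")
    case True
    define y where "y m = sqrt (2 * ln (2 / (\<alpha> m * (1 / real m)))) / sqrt (1 + u m)" for m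
    have "y \<longlonglongrightarrow> sqrt C" unfolding y_def
    proof (rule critical_value_limit[OF u_top _ _ ln_\<alpha> ev_\<alpha>])
      have "(\<lambda>m. ln (real m) / u m) \<longlonglongrightarrow> C / 2" using ln_m True by simp
      moreover have "eventually (\<lambda>m. ln (real m) / u m = - ln (1 / real m) / u m) sequentially"
        using ev1 by eventually_elim (simp add: ln_div)
      ultimately show "(\<lambda>m. - ln (1 / real m) / u m) \<longlonglongrightarrow> C / 2" by (rule Lim_transform_eventually)
      show "eventually (\<lambda>m. 0 < 1 / real m) sequentially" using ev1 by eventually_elim simp
    qed
    hence "(\<lambda>m. central_mass (y m)) \<longlonglongrightarrow> a"
      unfolding a_def by (rule isCont_tendsto_compose[OF isCont_central_mass])
    moreover have "eventually (\<lambda>m. T2 m \<le> real m * p m * central_mass (y m)) sequentially"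
      using ev1
    proof eventually_elim
      case (elim m)
      thus ?case
        using two_groups.false_acceptances_BH_le_single[OF model[OF elim] elim, of "\<alpha> m"] \<alpha>_bounds[OF elim]
        by (simp add: T2_def y_def u_def)
    qed
    ultimately show ?thesis by (rule that)
  next
    case False
    \<comment> \<open>Then \<open>8 \<kappa> = (1 - a) / 2\<close> lies below the limit \<open>1 - a\<close> of the hit probability of a signal.\<close>
    define \<kappa> where "\<kappa> = (1 - a) / 16"
    have \<kappa>: "0 < \<kappa>" "\<kappa> \<le> 1" using a by (auto simp: \<kappa>_def)
    define y where "y m = sqrt (2 * ln (2 / (\<alpha> m * (\<kappa> * p m)))) / sqrt (1 + u m)" for m
    have "y \<longlonglongrightarrow> sqrt C" unfolding y_def
    proof (rule critical_value_limit[OF u_top _ _ ln_\<alpha> ev_\<alpha>])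
      have "(\<lambda>m. - ln (p m) / u m - ln \<kappa> / u m) \<longlonglongrightarrow> C / 2 - 0"
        by (intro tendsto_diff ln_p tendsto_divide_0[OF tendsto_const u_inf])
      hence "(\<lambda>m. - ln (p m) / u m - ln \<kappa> / u m) \<longlonglongrightarrow> C / 2" by simp
      moreover have "eventually (\<lambda>m. - ln (p m) / u m - ln \<kappa> / u m = - ln (\<kappa> * p m) / u m) sequentially"
        using ev_p by eventually_elim (use \<kappa> in \<open>simp add: ln_mult_pos add_divide_distrib diff_divide_distrib\<close>)
      ultimately show "(\<lambda>m. - ln (\<kappa> * p m) / u m) \<longlonglongrightarrow> C / 2" by (rule Lim_transform_eventually)
      show "eventually (\<lambda>m. 0 < \<kappa> * p m) sequentially" using ev_p by eventually_elim (use \<kappa> in simp)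
    qed
    hence y: "(\<lambda>m. central_mass (y m)) \<longlonglongrightarrow> a"
      unfolding a_def by (rule isCont_tendsto_compose[OF isCont_central_mass])
    have "filterlim (\<lambda>m. real m * p m) at_top sequentially"
      using False \<beta> by (intro propto_power_limits(2)[OF c ev_p]) auto
    hence "filterlim (\<lambda>m. \<kappa> * (real m * p m)) at_top sequentially"
      by (rule filterlim_tendsto_pos_mult_at_top[OF tendsto_const \<kappa>(1)])
    hence "filterlim (\<lambda>m. - (\<kappa> * (real m * p m))) at_bot sequentially"
      by (simp add: filterlim_uminus_at_top)
    hence "(\<lambda>m. exp (- (\<kappa> * (real m * p m)))) \<longlonglongrightarrow> 0"
      by (rule filterlim_compose[OF exp_at_bot])
    with y have "(\<lambda>m. central_mass (y m) + exp (- (\<kappa> * (real m * p m)))) \<longlonglongrightarrow> a + 0"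
      by (rule tendsto_add)
    hence "(\<lambda>m. central_mass (y m) + exp (- (\<kappa> * (real m * p m)))) \<longlonglongrightarrow> a" by simp
    moreover have "eventually (\<lambda>m. central_mass (y m) < 1 - 8 * \<kappa>) sequentially"
      using y by (rule order_tendstoD) (use a in \<open>simp add: \<kappa>_def field_simps\<close>)
    hence "eventually (\<lambda>m. T2 m \<le> real m * p m * (central_mass (y m) + exp (- (\<kappa> * (real m * p m))))) sequentially"
      using eventually_ge_at_top[of 2]
    proof eventually_elim
      case (elim m)
      hence m: "m \<ge> 1" by simp
      show ?case
        using two_groups.false_acceptances_BH_le_many[OF model[OF m] elim(2) _ _ \<kappa>, of "\<alpha> m"] \<alpha>_bounds[OF m] elim(1)
        by (simp add: T2_def y_def u_def)
    qed
    ultimately show ?thesis by (rule that)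
  qed

  define e where "e m = (\<alpha> m + sqrt (\<alpha> m)) * exp 1" for m
  have sqrt_\<alpha>: "(\<lambda>m. sqrt (\<alpha> m)) \<longlonglongrightarrow> 0" using tendsto_real_sqrt[OF \<alpha>_lim] by simp
  have "e \<longlonglongrightarrow> (0 + 0) * exp 1" unfolding e_def
    by (intro tendsto_intros \<alpha>_lim sqrt_\<alpha>)
  hence e: "e \<longlonglongrightarrow> 0" by simp
  have e_small: "eventually (\<lambda>m. e m < 1 / 2) sequentially" using e by (rule order_tendstoD) simp
  \<comment> \<open>Lower and upper bounds for the two risks in units of \<open>\<delta>\<^sub>A m p\<close>.\<close>
  define l where "l m = central_mass (sqrt ((ln (v m) + ln (1 + 1 / u m)) / u m))" for m
  define H where "H m = \<delta> * (sqrt (\<alpha> m) + 8 / c * e m) + h m" for m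
  have H: "H \<longlonglongrightarrow> a"
  proof -
    have "H \<longlonglongrightarrow> \<delta> * (0 + 8 / c * 0) + a"
      unfolding H_def by (intro tendsto_intros sqrt_\<alpha> e h)
    thus ?thesis by simp
  qed
  have l: "l \<longlonglongrightarrow> a"
  proof -
    have "(\<lambda>m. 1 / u m) \<longlonglongrightarrow> 0" by (rule tendsto_divide_0[OF tendsto_const u_inf])
    hence "(\<lambda>m. ln (1 + 1 / u m)) \<longlonglongrightarrow> ln (1 + 0)" by (intro tendsto_intros) auto
    hence "(\<lambda>m. ln (1 + 1 / u m) / u m) \<longlonglongrightarrow> 0" by (rule tendsto_divide_0[OF _ u_inf])
    with vu have "(\<lambda>m. ln (v m) / u m + ln (1 + 1 / u m) / u m) \<longlonglongrightarrow> C + 0" by (rule tendsto_add)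
    hence "(\<lambda>m. sqrt ((ln (v m) + ln (1 + 1 / u m)) / u m)) \<longlonglongrightarrow> sqrt C"
      using tendsto_real_sqrt by (fastforce simp: add_divide_distrib)
    thus ?thesis unfolding l_def a_def by (rule isCont_tendsto_compose[OF isCont_central_mass])
  qed
  have l_pos: "eventually (\<lambda>m. 0 < l m) sequentially" using l a(1) by (rule order_tendstoD)
  have v1: "eventually (\<lambda>m. 1 \<le> v m) sequentially" using v_top by (simp add: filterlim_at_top)

  have opt_ge: "eventually (\<lambda>m. \<delta>\<^sub>A m * (real m * p m * l m) \<le> Ropt m) sequentially"
    using ev1 v1
  proof eventually_elim
    case (elim m)
    thus ?case
      using two_groups.bayes_risk_oracle_ge[OF model[OF elim(1)] losses(1,2)[OF elim(1)]]
      by (simp add: Ropt_def l_def u_def v_def)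
  qed
  have opt_le: "Ropt m \<le> R m" if m: "m \<ge> 1" for m
    unfolding R_def Ropt_def using \<alpha>_bounds[OF m]
    by (intro two_groups.bayes_oracle_minimizes_risk[OF model[OF m]] losses m BH_rule_measurable) auto
  have BH_le: "eventually (\<lambda>m. R m \<le> \<delta>\<^sub>A m * (real m * p m * H m)) sequentially"
    using ev1 e_small h(2) mp
  proof eventually_elim
    case (elim m)
    note m = elim(1)
    have "T1 m \<le> sqrt (\<alpha> m) * (real m * p m) + 4 * e m"
      using two_groups.false_rejections_BH_le[OF model[OF m] m, of "\<alpha> m"] \<alpha>_bounds[OF m] elim(2)
      by (simp add: T1_def e_def)
    also have "4 * e m \<le> 8 / c * e m * (real m * p m)"
    proof -
      have "0 \<le> e m" using \<alpha>_bounds[OF m] by (simp add: e_def)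
      hence "8 / c * e m * (c / 2) \<le> 8 / c * e m * (real m * p m)"
        using elim(4) c(1) by (intro mult_left_mono) auto
      thus ?thesis using c(1) by simp
    qed
    finally have T1: "T1 m \<le> real m * p m * (sqrt (\<alpha> m) + 8 / c * e m)"
      by (simp add: algebra_simps)
    have \<delta>0: "\<delta>\<^sub>0 m = \<delta>\<^sub>A m * \<delta>" using \<delta>_eq[OF m] losses(2)[OF m] by (simp add: field_simps)
    have "R m = \<delta>\<^sub>A m * (\<delta> * T1 m + T2 m)"
      by (simp add: R_def bayes_risk_def T1_def T2_def \<delta>0 algebra_simps)
    also have "\<dots> \<le> \<delta>\<^sub>A m * (\<delta> * (real m * p m * (sqrt (\<alpha> m) + 8 / c * e m)) + real m * p m * h m)"
      using T1 elim(3) \<delta> losses(2)[OF m] by (intro mult_left_mono add_mono) auto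
    also have "\<dots> = \<delta>\<^sub>A m * (real m * p m * H m)" by (simp add: H_def algebra_simps)
    finally show ?case .
  qed
  have bounds: "eventually (\<lambda>m. 1 \<le> R m / Ropt m \<and> R m / Ropt m \<le> H m / l m) sequentially"
    using ev1 l_pos opt_ge BH_le
  proof eventually_elim
    case (elim m)
    define w where "w = \<delta>\<^sub>A m * (real m * p m)"
    have w: "0 < w" using elim(1) losses(2)[OF elim(1)] p_pos[OF elim(1)] by (simp add: w_def)
    have lo: "w * l m \<le> Ropt m" and hi: "R m \<le> w * H m"
      using elim(3,4) by (simp_all add: w_def mult_ac)
    have pos: "0 < w * l m" using w elim(2) by simp
    have le: "Ropt m \<le> R m" by (rule opt_le[OF elim(1)])
    have "R m / Ropt m \<le> (w * H m) / (w * l m)"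
      using lo hi pos le by (intro frac_le) linarith+
    also have "\<dots> = H m / l m" using w by simp
    finally show ?case using lo pos le by simp
  qed
  have "(\<lambda>m. H m / l m) \<longlonglongrightarrow> a / a" using a by (intro tendsto_divide H l) auto
  hence upper: "(\<lambda>m. H m / l m) \<longlonglongrightarrow> 1" using a by simp
  have "(\<lambda>m. R m / Ropt m) \<longlonglongrightarrow> 1"
  proof (rule tendsto_sandwich[OF _ _ tendsto_const upper])
    show "eventually (\<lambda>m. 1 \<le> R m / Ropt m) sequentially"
      using bounds by (rule eventually_mono) blast
    show "eventually (\<lambda>m. R m / Ropt m \<le> H m / l m) sequentially"
      using bounds by (rule eventually_mono) blast
  qed
  thus ?thesis by (simp add: ABOS_def R_def Ropt_def)
qed

end
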